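(* There exists a positive constant $C$ such that the following holds. For a positive integer $N$, let $A$ be a random subset of $\mathbb{Z}_N$ in which each element is chosen independently with probability $C(\log N)^{1/3}N^{-2/3}$. Then, with probability tending to $1$ as $N\to\infty$, every Freiman homomorphism from $A$ to $\mathbb{Z}_N$ is affine.
   Context: A Freiman homomorphism from a subset $A\subset\mathbb{Z}_N$ to $\mathbb{Z}_N$ is a function $\phi:A\to\mathbb{Z}_N$ such that $\phi(a)+\phi(b)=\phi(c)+\phi(d)$ whenever $a,b,c,d\in A$ satisfy $a+b=c+d$. Such a $\phi$ is affine if there exist $r,s\in\mathbb{Z}_N$ with $\phi(a)=ra+s$ for every $a\in A$. *)

theory Defs
  imports "HOL-Probability.Probability" "HOL-Number_Theory.Residues"
begin

abbreviation Z_mod :: "nat \<Rightarrow> int ring" where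
  "Z_mod N \<equiv> residue_ring (int N)"

(* Only the values of phi on A matter; outside A phi is arbitrary. *)
definition freiman_hom :: "nat \<Rightarrow> int set \<Rightarrow> (int \<Rightarrow> int) \<Rightarrow> bool" where
  "freiman_hom N A \<phi> \<longleftrightarrow>
     A \<subseteq> carrier (Z_mod N) \<and> \<phi> \<in> A \<rightarrow> carrier (Z_mod N) \<and>
     (\<forall>a\<in>A. \<forall>b\<in>A. \<forall>c\<in>A. \<forall>d\<in>A.
        a \<oplus>\<^bsub>Z_mod N\<^esub> b = c \<oplus>\<^bsub>Z_mod N\<^esub> d \<longrightarrow>
        \<phi> a \<oplus>\<^bsub>Z_mod N\<^esub> \<phi> b = \<phi> c \<oplus>\<^bsub>Z_mod N\<^esub> \<phi> d)"

definition affine_on :: "nat \<Rightarrow> int set \<Rightarrow> (int \<Rightarrow> int) \<Rightarrow> bool" where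
  "affine_on N A \<phi> \<longleftrightarrow>
     (\<exists>r\<in>carrier (Z_mod N). \<exists>s\<in>carrier (Z_mod N). \<forall>a\<in>A.
        \<phi> a = (r \<otimes>\<^bsub>Z_mod N\<^esub> a) \<oplus>\<^bsub>Z_mod N\<^esub> s)"

(* The distribution of a random subset of the finite set S containing each element
   independently with probability p.  Note that bernoulli_pmf truncates p to [0, 1]. *)
definition random_subset :: "real \<Rightarrow> 'a set \<Rightarrow> 'a set pmf" where
  "random_subset p S =
     map_pmf (\<lambda>f. {x \<in> S. f x}) (Pi_pmf S False (\<lambda>_. bernoulli_pmf p))"

end

theory Submission
  imports Defs "HOL-Real_Asymp.Real_Asymp"
begin

text \<open>Write \<open>p\<close> for the density, \<open>n = N p\<close>, and fix a set \<open>W\<close> of small but positive density such that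
  every \<open>x\<close> outside \<open>W\<close> has many representations \<open>x = c + d - b\<close> with \<open>b, c, d\<close> in \<open>W\<close>. By Janson's
  inequality every such \<open>x\<close> is represented in \<open>B = A \<inter> W\<close>, so a Freiman homomorphism \<open>\<phi>\<close> is determined
  by its restriction to \<open>B\<close>, which extends to a map \<open>\<Phi>\<close> on almost all of \<open>\<int>\<^sub>N\<close> agreeing with \<open>\<phi>\<close> on
  \<open>A - W\<close>. If \<open>\<Phi>\<close> violated a positive proportion of all additive quadruples, then \<open>A - W\<close> would contain
  a violated quadruple, except with probability \<open>exp (- c n)\<close>. There are too many maps \<open>\<phi>\<close> on \<open>B\<close> for
  a union bound, but a violation by \<open>v \<noteq> 0\<close> is still visible after multiplying by a random
  \<open>m\<close> and rounding \<open>m \<phi> / N\<close> to one of 150 values, and there are only \<open>150 ^ card B\<close> rounded maps.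

  Hence \<open>\<Phi>\<close> respects almost all additive quadruples of \<open>\<int>\<^sub>N\<close>, so it agrees with an affine map \<open>L\<close>
  almost everywhere, and by the same rounding argument \<open>\<phi> = L\<close> outside a set \<open>E\<close> of at most
  \<open>n / 3500\<close> elements of \<open>A\<close>. No additive quadruple of \<open>A\<close> can have exactly one element in \<open>E\<close>. A first
  moment computation, again with Janson's inequality, shows that with high probability \<open>A\<close> has no
  nonempty subset of this size with that property.\<close>

section \<open>Expectations over random subsets and a form of Janson's inequality\<close>

text \<open>A finite weighted sum instead of an integral over a probability mass function: it allows
  induction on \<open>S\<close>, exchange with sums and termwise differentiation.
  \<open>prob_random_subset\<close> links it to \<open>random_subset\<close>.\<close>

definition subset_expectation :: "real \<Rightarrow> 'a set \<Rightarrow> ('a set \<Rightarrow> real) \<Rightarrow> real" where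
  "subset_expectation p S f = (\<Sum>A\<in>Pow S. p ^ card A * (1 - p) ^ card (S - A) * f A)"

lemma subset_expectation_empty [simp]: "subset_expectation p {} f = f {}"
  by (simp add: subset_expectation_def)

lemma subset_expectation_insert:
  assumes "finite S" "x \<notin> S"
  shows "subset_expectation p (insert x S) f =
    p * subset_expectation p S (\<lambda>A. f (insert x A)) + (1 - p) * subset_expectation p S f"
proof -
  let ?w = "\<lambda>S A. p ^ card A * (1 - p) ^ card (S - A)"
  have disj: "Pow S \<inter> insert x ` Pow S = {}" and inj: "inj_on (insert x) (Pow S)"
    using assms by (auto simp: inj_on_def)
  have 1: "?w (insert x S) A = (1 - p) * ?w S A" if "A \<in> Pow S" for A
  proof -
    have "insert x S - A = insert x (S - A)" using that assms by auto
    then show ?thesis using assms that by (simp add: finite_subset)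
  qed
  have 2: "?w (insert x S) (insert x A) = p * ?w S A" if "A \<in> Pow S" for A
  proof -
    have "insert x S - insert x A = S - A" "x \<notin> A" "finite A"
      using that assms by (auto intro: finite_subset)
    then show ?thesis by simp
  qed
  have "subset_expectation p (insert x S) f =
    (\<Sum>A\<in>Pow S. ?w (insert x S) A * f A)
    + (\<Sum>A\<in>Pow S. ?w (insert x S) (insert x A) * f (insert x A))"
    using assms disj
    by (simp add: subset_expectation_def Pow_insert sum.union_disjoint sum.reindex[OF inj])
  also have "\<dots> = (\<Sum>A\<in>Pow S. (1 - p) * ?w S A * f A) + (\<Sum>A\<in>Pow S. p * ?w S A * f (insert x A))"
    by (intro arg_cong2[where f="(+)"] sum.cong refl) (simp_all only: 1 2)
  finally show ?thesis
    by (simp add: subset_expectation_def sum_distrib_left mult.assoc)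
qed

lemma subset_expectation_add:
  "subset_expectation p S (\<lambda>A. f A + g A) = subset_expectation p S f + subset_expectation p S g"
  by (simp add: subset_expectation_def sum.distrib distrib_left)

lemma subset_expectation_cmult:
  "subset_expectation p S (\<lambda>A. c * f A) = c * subset_expectation p S f"
  by (simp add: subset_expectation_def sum_distrib_left mult_ac)

lemma subset_expectation_sum:
  "subset_expectation p S (\<lambda>A. \<Sum>i\<in>I. f i A) = (\<Sum>i\<in>I. subset_expectation p S (f i))"
  unfolding subset_expectation_def by (subst sum.swap) (simp add: sum_distrib_left)

lemma subset_expectation_mono:
  assumes "0 \<le> p" "p \<le> 1" "\<And>A. A \<subseteq> S \<Longrightarrow> f A \<le> g A"
  shows "subset_expectation p S f \<le> subset_expectation p S g"
  unfolding subset_expectation_def using assms by (intro sum_mono mult_left_mono) auto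

lemma subset_expectation_cong:
  assumes "\<And>A. A \<subseteq> S \<Longrightarrow> f A = g A"
  shows "subset_expectation p S f = subset_expectation p S g"
  unfolding subset_expectation_def using assms by (intro sum.cong) auto

lemma subset_expectation_const [simp]:
  "finite S \<Longrightarrow> subset_expectation p S (\<lambda>_. c) = c"
  by (induction S rule: finite_induct) (simp_all add: subset_expectation_insert algebra_simps)

lemma subset_expectation_le_const:
  assumes "finite S" "0 \<le> p" "p \<le> 1" "\<And>A. A \<subseteq> S \<Longrightarrow> f A \<le> c"
  shows "subset_expectation p S f \<le> c"
  using subset_expectation_mono[of p S f "\<lambda>_. c"] assms by simp

lemma subset_expectation_nonneg:
  assumes "0 \<le> p" "p \<le> 1" "\<And>A. A \<subseteq> S \<Longrightarrow> 0 \<le> f A"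
  shows "0 \<le> subset_expectation p S f"
  unfolding subset_expectation_def using assms by (intro sum_nonneg mult_nonneg_nonneg) auto

lemma subset_expectation_Un:
  assumes "finite S" "finite T" "S \<inter> T = {}"
  shows "subset_expectation p (S \<union> T) f =
    subset_expectation p S (\<lambda>A. subset_expectation p T (\<lambda>B. f (A \<union> B)))"
  using assms
proof (induction S arbitrary: f rule: finite_induct)
  case (insert x S)
  then show ?case by (simp add: subset_expectation_insert)
qed simp

text \<open>The elements of \<open>T\<close> are chosen independently of the rest, so conditioning
  on \<open>T \<subseteq> A\<close>, an event of probability \<open>p ^ card T\<close>, has the same
  effect as adding \<open>T\<close> to \<open>A\<close>.\<close>

lemma subset_expectation_superset:
  assumes "finite S" "T \<subseteq> S"
  shows "subset_expectation p S (\<lambda>A. of_bool (T \<subseteq> A) * f A) =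
    p ^ card T * subset_expectation p S (\<lambda>A. f (A \<union> T))"
proof -
  have fin: "finite T" "finite (S - T)" using assms by (auto intro: finite_subset)
  have split: "subset_expectation p S h =
      subset_expectation p (S - T) (\<lambda>A. subset_expectation p T (\<lambda>B. h (A \<union> B)))" for h
    using subset_expectation_Un[of "S - T" T p h] fin assms(2)
    by (simp add: Un_absorb2 Int_commute Diff_disjoint Un_Diff_cancel2)
  have inner: "subset_expectation p T (\<lambda>B. of_bool (T \<subseteq> A \<union> B) * f (A \<union> B)) = p ^ card T * f (A \<union> T)"
    if "A \<subseteq> S - T" for A
  proof -
    have "subset_expectation p T (\<lambda>B. of_bool (T \<subseteq> A \<union> B) * f (A \<union> B))
      = (\<Sum>B\<in>{T}. p ^ card B * (1 - p) ^ card (T - B) * (of_bool (T \<subseteq> A \<union> B) * f (A \<union> B)))"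
      unfolding subset_expectation_def
      using that fin by (intro sum.mono_neutral_right) auto
    then show ?thesis by simp
  qed
  have inner': "subset_expectation p T (\<lambda>B. f (A \<union> B \<union> T)) = f (A \<union> T)" for A
  proof -
    have "subset_expectation p T (\<lambda>B. f (A \<union> B \<union> T)) = subset_expectation p T (\<lambda>B. f (A \<union> T))"
      by (intro subset_expectation_cong arg_cong[where f=f]) auto
    then show ?thesis using fin by simp
  qed
  show ?thesis
    unfolding split inner'
    by (simp add: inner subset_expectation_cmult[symmetric] cong: subset_expectation_cong)
qed

text \<open>Harris's correlation inequality for two decreasing functions. Revealing one element of
  \<open>S\<close> at a time reduces it to Chebyshev's inequality on a two-point space.\<close>

lemma subset_expectation_Harris:
  assumes "finite S" "0 \<le> p" "p \<le> 1"
    and "\<And>A B. A \<subseteq> B \<Longrightarrow> B \<subseteq> S \<Longrightarrow> f B \<le> f A"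
    and "\<And>A B. A \<subseteq> B \<Longrightarrow> B \<subseteq> S \<Longrightarrow> g B \<le> g A"
  shows "subset_expectation p S f * subset_expectation p S g \<le> subset_expectation p S (\<lambda>A. f A * g A)"
  using assms(1,4,5)
proof (induction S arbitrary: f g rule: finite_induct)
  case empty
  then show ?case by simp
next
  case (insert x S)
  define f1 g1 where "f1 = (\<lambda>A. f (insert x A))" and "g1 = (\<lambda>A. g (insert x A))"
  let ?E = "subset_expectation p S"
  have prems: "f B \<le> f A" "g B \<le> g A" if "A \<subseteq> B" "B \<subseteq> S \<or> B \<subseteq> insert x S" for A B
    using that insert.prems[of A B] by (auto simp: subset_insertI2)
  have IH0: "?E f * ?E g \<le> ?E (\<lambda>A. f A * g A)"
    by (intro insert.IH prems) simp_all
  have IH1: "?E f1 * ?E g1 \<le> ?E (\<lambda>A. f1 A * g1 A)"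
    unfolding f1_def g1_def by (intro insert.IH prems; blast)
  have le: "?E f1 \<le> ?E f" "?E g1 \<le> ?E g"
    unfolding f1_def g1_def using assms(2,3)
    by (auto intro!: subset_expectation_mono prems)
  \<comment> \<open>The covariance of two functions on a two-point space. It is nonnegative below
    because adding \<open>x\<close> can only decrease \<open>f\<close> and \<open>g\<close>.\<close>
  have id: "(p * a + (1 - p) * b) * (p * c + (1 - p) * d) =
      p * (a * c) + (1 - p) * (b * d) - p * (1 - p) * ((b - a) * (d - c))" for a b c d :: real
    by (simp add: algebra_simps)
  have "0 \<le> p * (1 - p) * ((?E f - ?E f1) * (?E g - ?E g1))"
    using le assms(2,3) by simp
  moreover have "p * (?E f1 * ?E g1) \<le> p * ?E (\<lambda>A. f1 A * g1 A)"
    using IH1 assms(2) by (rule mult_left_mono)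
  moreover have "(1 - p) * (?E f * ?E g) \<le> (1 - p) * ?E (\<lambda>A. f A * g A)"
    using IH0 assms(3) by (intro mult_left_mono) auto
  ultimately show ?case
    using insert.hyps unfolding f1_def g1_def
    by (simp add: subset_expectation_insert id)
qed

text \<open>A weak Janson inequality: given \<open>T i \<subseteq> A\<close>, the expected number of
  sets \<open>T j\<close> in \<open>A\<close> that meet \<open>T i\<close> is at most
  \<open>\<delta>\<close>. For the Laplace transform \<open>\<Psi>\<close> of the number
  \<open>X\<close> of sets contained in \<open>A\<close>, Harris's inequality bounds the logarithmic
  derivative by \<open>- \<mu> / 2\<close> up to \<open>s = 1 / (2 * \<delta>)\<close>; integration
  gives the result.\<close>

lemma Janson_uniform:
  fixes T :: "'i \<Rightarrow> 'a set"
  assumes S: "finite S" and p: "0 \<le> p" "p \<le> 1" and I: "finite I"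
    and TS: "\<And>i. i \<in> I \<Longrightarrow> T i \<subseteq> S"
    and \<delta>: "0 < \<delta>" "\<And>i. i \<in> I \<Longrightarrow> (\<Sum>j | j \<in> I \<and> T j \<inter> T i \<noteq> {}. p ^ card (T j - T i)) \<le> \<delta>"
    and \<mu>: "\<mu> \<le> (\<Sum>i\<in>I. p ^ card (T i))"
  shows "subset_expectation p S (\<lambda>A. of_bool (\<forall>i\<in>I. \<not> T i \<subseteq> A)) \<le> exp (- \<mu> / (4 * \<delta>))"
proof -
  define X where "X A = (\<Sum>i\<in>I. of_bool (T i \<subseteq> A) :: real)" for A
  \<comment> \<open>\<open>Y i A\<close> counts the sets meeting \<open>T i\<close> that lie in
    \<open>A\<close> once \<open>T i\<close> has been added.\<close>
  define Y where "Y i A = (\<Sum>j | j \<in> I \<and> T j \<inter> T i \<noteq> {}. of_bool (T j - T i \<subseteq> A) :: real)" for i A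
  let ?E = "subset_expectation p S"
  define \<Psi> where "\<Psi> s = ?E (\<lambda>A. exp (- s * X A))" for s
  have X_mono: "X A \<le> X B" if "A \<subseteq> B" for A B
    unfolding X_def using that by (intro sum_mono) auto
  have Y_mono: "Y i A \<le> Y i B" if "A \<subseteq> B" for A B i
    unfolding Y_def using that by (intro sum_mono) auto
  have Psi_nonneg: "0 \<le> \<Psi> s" for s
    unfolding \<Psi>_def using p by (intro subset_expectation_nonneg) auto
  have X_Un: "X (A \<union> T i) \<le> Y i A + X A" if "i \<in> I" for A i
  proof -
    have "X (A \<union> T i) \<le> (\<Sum>j\<in>I. of_bool (T j \<inter> T i \<noteq> {} \<and> T j - T i \<subseteq> A) + of_bool (T j \<subseteq> A))"
      unfolding X_def by (intro sum_mono) (auto simp: of_bool_def)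
    also have "\<dots> = Y i A + X A"
      unfolding Y_def X_def using I
      by (simp add: sum.distrib sum.inter_filter of_bool_conj flip: of_bool_def
          cong: if_cong) (simp add: of_bool_def if_distrib sum.If_cases Int_def conj_ac cong: if_cong)
    finally show ?thesis .
  qed
  have E_Y: "?E (Y i) \<le> \<delta>" if "i \<in> I" for i
  proof -
    have "?E (\<lambda>A. of_bool (T j - T i \<subseteq> A)) = p ^ card (T j - T i)" if "j \<in> I" for j
      using subset_expectation_superset[of S "T j - T i" p "\<lambda>_. 1"] S TS[OF that] by auto
    then show ?thesis
      unfolding Y_def subset_expectation_sum using \<delta>(2)[OF that] by simp
  qed
  have step: "\<mu> / 2 * \<Psi> s \<le> ?E (\<lambda>A. X A * exp (- s * X A))" if s: "0 \<le> s" "s \<le> 1 / (2 * \<delta>)" for s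
  proof -
    have "p ^ card (T i) * (\<Psi> s / 2) \<le> ?E (\<lambda>A. of_bool (T i \<subseteq> A) * exp (- s * X A))" if i: "i \<in> I" for i
    proof -
      \<comment> \<open>By \<open>exp (- y) >= 1 - y\<close>, a mean of \<open>s * Y i\<close> of at
        most 1/2 keeps the mean of \<open>exp (- s * Y i)\<close> at least 1/2. This is what limits
        \<open>s\<close> to \<open>1 / (2 * \<delta>)\<close>.\<close>
      have "s * ?E (Y i) \<le> s * \<delta>" using E_Y[OF i] s(1) by (rule mult_left_mono)
      also have "\<dots> \<le> 1 / (2 * \<delta>) * \<delta>" using s \<delta> by (intro mult_right_mono) auto
      finally have "1 / 2 \<le> 1 - s * ?E (Y i)" using \<delta> by simp
      also have "\<dots> = ?E (\<lambda>A. 1 + (- s) * Y i A)"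
        using S by (simp only: subset_expectation_add subset_expectation_cmult) simp
      also have "\<dots> \<le> ?E (\<lambda>A. exp (- s * Y i A))"
        using p by (intro subset_expectation_mono exp_ge_add_one_self)
      finally have half: "1 / 2 \<le> ?E (\<lambda>A. exp (- s * Y i A))" .
      have "\<Psi> s / 2 \<le> ?E (\<lambda>A. exp (- s * Y i A)) * \<Psi> s"
        using mult_right_mono[OF half Psi_nonneg[of s]] by simp
      also have "\<dots> \<le> ?E (\<lambda>A. exp (- s * Y i A) * exp (- s * X A))"
        unfolding \<Psi>_def using S p s
        by (intro subset_expectation_Harris) (auto intro!: mult_left_mono X_mono Y_mono)
      also have "\<dots> \<le> ?E (\<lambda>A. exp (- s * X (A \<union> T i)))"
      proof (intro subset_expectation_mono p)
        fix A
        have "s * X (A \<union> T i) \<le> s * (Y i A + X A)"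
          using X_Un[OF i] s(1) by (rule mult_left_mono)
        then show "exp (- s * Y i A) * exp (- s * X A) \<le> exp (- s * X (A \<union> T i))"
          by (simp add: exp_add[symmetric] algebra_simps)
      qed
      finally have "p ^ card (T i) * (\<Psi> s / 2) \<le> p ^ card (T i) * ?E (\<lambda>A. exp (- s * X (A \<union> T i)))"
        using p by (intro mult_left_mono) auto
      then show ?thesis
        using subset_expectation_superset[OF S TS[OF i], of p "\<lambda>A. exp (- s * X A)"] by simp
    qed
    then have "(\<Sum>i\<in>I. p ^ card (T i) * (\<Psi> s / 2)) \<le>
        (\<Sum>i\<in>I. ?E (\<lambda>A. of_bool (T i \<subseteq> A) * exp (- s * X A)))"
      by (rule sum_mono)
    also have "\<dots> = ?E (\<lambda>A. X A * exp (- s * X A))"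
      unfolding subset_expectation_sum[symmetric] X_def by (simp add: sum_distrib_right)
    finally have "(\<Sum>i\<in>I. p ^ card (T i)) * (\<Psi> s / 2) \<le> ?E (\<lambda>A. X A * exp (- s * X A))"
      unfolding sum_distrib_right .
    moreover have "\<mu> * (\<Psi> s / 2) \<le> (\<Sum>i\<in>I. p ^ card (T i)) * (\<Psi> s / 2)"
      using \<mu> Psi_nonneg[of s] by (intro mult_right_mono) auto
    ultimately show ?thesis by simp
  qed
  have deriv: "(\<Psi> has_real_derivative - ?E (\<lambda>A. X A * exp (- s * X A))) (at s)" for s
    unfolding \<Psi>_def subset_expectation_def
    by (auto intro!: derivative_eq_intros sum.cong simp: sum_negf[symmetric])
  \<comment> \<open>The inequality \<open>step\<close> says that
    \<open>\<Psi> s * exp (\<mu> / 2 * s)\<close> has nonpositive derivative on this range.\<close>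
  have "\<Psi> (1 / (2 * \<delta>)) * exp (\<mu> / 2 * (1 / (2 * \<delta>))) \<le> \<Psi> 0 * exp (\<mu> / 2 * 0)"
  proof (rule DERIV_nonpos_imp_nonincreasing[where f = "\<lambda>s. \<Psi> s * exp (\<mu> / 2 * s)"])
    show "0 \<le> 1 / (2 * \<delta>)" using \<delta> by simp
    fix s assume s: "0 \<le> s" "s \<le> 1 / (2 * \<delta>)"
    have "((\<lambda>s. \<Psi> s * exp (\<mu> / 2 * s)) has_real_derivative
        (\<mu> / 2 * \<Psi> s - ?E (\<lambda>A. X A * exp (- s * X A))) * exp (\<mu> / 2 * s)) (at s)"
      by (auto intro!: derivative_eq_intros deriv simp: algebra_simps)
    moreover have "(\<mu> / 2 * \<Psi> s - ?E (\<lambda>A. X A * exp (- s * X A))) * exp (\<mu> / 2 * s) \<le> 0"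
      using step[OF s] by (intro mult_nonpos_nonneg) auto
    ultimately show "\<exists>y. ((\<lambda>s. \<Psi> s * exp (\<mu> / 2 * s)) has_real_derivative y) (at s) \<and> y \<le> 0"
      by blast
  qed
  also have "\<Psi> 0 * exp (\<mu> / 2 * 0) = 1"
    unfolding \<Psi>_def using S by simp
  finally have "\<Psi> (1 / (2 * \<delta>)) \<le> 1 / exp (\<mu> / (4 * \<delta>))"
    by (simp add: field_simps)
  then have "\<Psi> (1 / (2 * \<delta>)) \<le> exp (- \<mu> / (4 * \<delta>))"
    by (simp add: exp_minus inverse_eq_divide)
  \<comment> \<open>If no \<open>T i\<close> lies in \<open>A\<close>, then \<open>X A = 0\<close>
    and the exponential is 1, so it dominates the indicator.\<close>
  moreover have "?E (\<lambda>A. of_bool (\<forall>i\<in>I. \<not> T i \<subseteq> A)) \<le> \<Psi> (1 / (2 * \<delta>))"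
    unfolding \<Psi>_def X_def using p by (intro subset_expectation_mono) auto
  ultimately show ?thesis by linarith
qed

text \<open>Induction on \<open>S\<close>, deciding one element by a coin. \<open>Q\<close> is
  generalised because choosing \<open>x\<close> leads to the event
  \<open>insert x A \<in> Q\<close>; the bounds on \<open>p\<close> rule out the truncation in
  \<open>bernoulli_pmf\<close>.\<close>

lemma prob_random_subset:
  assumes "finite S" "0 \<le> p" "p \<le> 1"
  shows "measure_pmf.prob (random_subset p S) Q = subset_expectation p S (\<lambda>A. of_bool (A \<in> Q))"
  using assms(1)
proof (induction S arbitrary: Q rule: finite_induct)
  case empty
  then show ?case by (simp add: random_subset_def measure_return_pmf indicator_def of_bool_def)
next
  case (insert x S)
  let ?B = "Pi_pmf S False (\<lambda>_. bernoulli_pmf p)"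
  have "random_subset p (insert x S) =
    bind_pmf (bernoulli_pmf p) (\<lambda>b. map_pmf (\<lambda>f. {y \<in> insert x S. (f(x := b)) y}) ?B)"
    unfolding random_subset_def
    by (subst Pi_pmf_insert'[OF insert.hyps]) (simp add: map_bind_pmf map_pmf_def[symmetric] map_pmf_comp bind_assoc_pmf o_def bind_return_pmf)
  also have "\<dots> = bind_pmf (bernoulli_pmf p) (\<lambda>b. map_pmf (\<lambda>A. if b then insert x A else A) (random_subset p S))"
    unfolding random_subset_def map_pmf_comp
    using insert.hyps by (intro bind_pmf_cong refl map_pmf_cong) auto
  finally have eq: "random_subset p (insert x S) = \<dots>" .
  have "emeasure (random_subset p (insert x S)) Q =
    ennreal (p * measure_pmf.prob (random_subset p S) {A. insert x A \<in> Q}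
      + (1 - p) * measure_pmf.prob (random_subset p S) Q)"
    unfolding eq using assms(2,3)
    by (simp add: vimage_def measure_pmf.emeasure_eq_measure[symmetric] ennreal_mult' mult.commute)
  then have "measure_pmf.prob (random_subset p (insert x S)) Q
     = p * measure_pmf.prob (random_subset p S) {A. insert x A \<in> Q} + (1 - p) * measure_pmf.prob (random_subset p S) Q"
    using assms(2,3) by (simp add: measure_def del: ennreal_plus)
  then show ?case
    using insert by (simp add: subset_expectation_insert)
qed

section \<open>Rounding residues\<close>

text \<open>The carrier of \<open>Z_mod N\<close> without its ring structure. From here on maps have
  integer values, and equality modulo \<open>N\<close> is expressed by divisibility.\<close>

definition residues_below :: "nat \<Rightarrow> int set" where
  "residues_below N = {0..<int N}"

lemma finite_residues_below [simp]: "finite (residues_below N)"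
  by (simp add: residues_below_def)

lemma card_residues_below [simp]: "card (residues_below N) = N"
  by (simp add: residues_below_def)

lemma mod_in_residues_below [simp]: "0 < N \<Longrightarrow> x mod int N \<in> residues_below N"
  by (simp add: residues_below_def)

lemma residues_below_eqI:
  assumes "x \<in> residues_below N" "y \<in> residues_below N" "int N dvd x - y"
  shows "x = y"
  using assms by (metis atLeastLessThan_iff mod_eq_dvd_iff mod_pos_pos_trivial residues_below_def)

lemma dvd_diff_mod [simp]: "int N dvd x - x mod int N"
  by (simp add: minus_mod_eq_mult_div)

lemma bij_betw_shift_residues:
  assumes "0 < N"
  shows "bij_betw (\<lambda>x. (x + d) mod int N) (residues_below N) (residues_below N)"
proof -
  have "inj_on (\<lambda>x. (x + d) mod int N) (residues_below N)"
  proof (intro inj_onI residues_below_eqI)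
    fix x y assume *: "x \<in> residues_below N" "y \<in> residues_below N"
      "(x + d) mod int N = (y + d) mod int N"
    from *(3) have "int N dvd (x + d) - (y + d)" by (simp add: mod_eq_dvd_iff)
    then show "int N dvd x - y" by simp
  qed
  moreover have "(\<lambda>x. (x + d) mod int N) ` residues_below N \<subseteq> residues_below N"
    using assms by auto
  ultimately show ?thesis
    by (simp add: bij_betw_def endo_inj_surj)
qed

text \<open>For positive \<open>N\<close> this is \<open>||v / N|| >= 1/6\<close>, with
  \<open>||.||\<close> the distance to the nearest integer, stated without division.\<close>

definition far_from_zero :: "nat \<Rightarrow> int \<Rightarrow> bool" where
  "far_from_zero N v \<longleftrightarrow> (\<forall>z. int N \<le> 6 * \<bar>v - int N * z\<bar>)"

lemma far_from_zero_mod: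
  "far_from_zero N (v mod int N) \<longleftrightarrow> far_from_zero N v"
proof -
  have "v mod int N - int N * z = v - int N * (v div int N + z)" for z
    using mult_div_mod_eq[of "int N" v] by (simp add: algebra_simps)
  moreover have "v - int N * z = v mod int N - int N * (z - v div int N)" for z
    using mult_div_mod_eq[of "int N" v] by (simp add: algebra_simps)
  ultimately show ?thesis
    unfolding far_from_zero_def by metis
qed

text \<open>Let \<open>d\<close> be the residue of \<open>v\<close>. If \<open>d < 2 N / 3\<close>,
  some multiple of \<open>d\<close> falls between \<open>N / 3\<close> and \<open>2 N / 3\<close>,
  since steps shorter than \<open>N / 3\<close> cannot jump over that interval. A larger residue is
  treated through \<open>- v\<close>, whose residue is \<open>N - d\<close>.\<close>

lemma ex_multiplier_middle_third:
  assumes "0 < N" "\<not> int N dvd v"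
  shows "\<exists>m. \<forall>z. int N \<le> 3 * \<bar>m * v - int N * z\<bar>"
proof -
  have mid: "int N \<le> 3 * \<bar>t - int N * z\<bar>" if "int N \<le> 3 * t" "3 * t \<le> 2 * int N" for t z
  proof (cases "z \<le> 0")
    case True
    then have "int N * z \<le> 0" by (simp add: mult_nonneg_nonpos)
    moreover have "n \<le> 3 * \<bar>t - w\<bar>" if "n \<le> 3 * t" "w \<le> 0" for n w :: int
      using that by arith
    ultimately show ?thesis using that by blast
  next
    case False
    then have "int N * 1 \<le> int N * z" by (intro mult_left_mono) auto
    moreover have "n \<le> 3 * \<bar>t - w\<bar>" if "3 * t \<le> 2 * n" "n * 1 \<le> w" for n w :: int
      using that by arith
    ultimately show ?thesis using that by blast
  qed
  have small: "\<exists>m. int N \<le> 3 * (m * d) \<and> 3 * (m * d) \<le> 2 * int N"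
    if d: "0 < d" "3 * d < 2 * int N" for d
  proof (cases "3 * d \<ge> int N")
    case True
    then show ?thesis using d by (intro exI[of _ 1]) auto
  next
    case False
    \<comment> \<open>The least multiplier for which \<open>m * d\<close> exceeds
      \<open>N / 3\<close>; as \<open>d < N / 3\<close>, the product stays below
      \<open>2 N / 3\<close>.\<close>
    define m where "m = int N div (3 * d) + 1"
    have "int N = (int N div (3 * d)) * (3 * d) + int N mod (3 * d)"
      by (rule div_mult_mod_eq[symmetric])
    moreover have "0 \<le> int N mod (3 * d)" "int N mod (3 * d) < 3 * d" using d by auto
    ultimately have "int N \<le> m * (3 * d)" "m * (3 * d) \<le> int N + 3 * d"
      unfolding m_def by (simp_all add: distrib_right)
    then show ?thesis using False by (intro exI[of _ m]) (auto simp: algebra_simps)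
  qed
  define d where "d = v mod int N"
  have d: "0 < d" "d < int N"
    using assms pos_mod_sign[of "int N" v] pos_mod_bound[of "int N" v]
    unfolding d_def dvd_eq_mod_eq_0 by linarith+
  have v: "v = d + int N * (v div int N)" unfolding d_def by simp
  show ?thesis
  proof (cases "3 * d < 2 * int N")
    case True
    then obtain m where m: "int N \<le> 3 * (m * d)" "3 * (m * d) \<le> 2 * int N" using small d by blast
    have "m * v - int N * z = m * d - int N * (z - m * (v div int N))" for z
      by (subst v) (simp add: algebra_simps)
    then show ?thesis using mid[OF m] by (intro exI[of _ m]) auto
  next
    case False
    then have "0 < int N - d" "3 * (int N - d) < 2 * int N" using d by auto
    then obtain m where m: "int N \<le> 3 * (m * (int N - d))" "3 * (m * (int N - d)) \<le> 2 * int N"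
      using small by blast
    have "- m * v - int N * z = m * (int N - d) - int N * (z + m * (v div int N) + m)" for z
      by (subst v) (simp add: algebra_simps)
    then show ?thesis using mid[OF m] by (intro exI[of _ "-m"]) auto
  qed
qed

text \<open>If \<open>m\<^sub>0 v\<close> is at distance at least \<open>N / 3\<close> from \<open>N\<int>\<close>, then one of \<open>m v\<close>, \<open>(m + m\<^sub>0) v\<close>
  is at distance at least \<open>N / 6\<close>.\<close>
lemma half_multipliers_far:
  assumes N: "0 < N" and v: "\<not> int N dvd v"
  shows "N \<le> 2 * card {m \<in> residues_below N. far_from_zero N (m * v)}"
proof -
  obtain m0 where m0: "\<And>z. int N \<le> 3 * \<bar>m0 * v - int N * z\<bar>"
    using ex_multiplier_middle_third[OF assms] by blast
  let ?F = "{m \<in> residues_below N. far_from_zero N (m * v)}"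
  let ?G = "{m \<in> residues_below N. \<not> far_from_zero N (m * v)}"
  have "far_from_zero N ((m + m0) mod int N * v)" if m: "m \<in> ?G" for m
  proof -
    from m obtain z where z: "6 * \<bar>m * v - int N * z\<bar> < int N"
      by (auto simp: far_from_zero_def not_le)
    have "int N \<le> 6 * \<bar>(m + m0) * v - int N * z'\<bar>" for z'
    proof -
      have "\<bar>m0 * v - int N * (z' - z)\<bar> \<le> \<bar>(m + m0) * v - int N * z'\<bar> + \<bar>m * v - int N * z\<bar>"
        by (simp add: algebra_simps abs_if)
      moreover have "n \<le> 6 * b" if "a \<le> b + c" "n \<le> 3 * a" "6 * c < n" for a b c n :: int
        using that by arith
      ultimately show ?thesis using m0[of "z' - z"] z by blast
    qed
    then have "far_from_zero N ((m + m0) * v)" by (simp add: far_from_zero_def)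
    then show ?thesis
      by (metis far_from_zero_mod mod_mult_left_eq)
  qed
  then have "(\<lambda>m. (m + m0) mod int N) ` ?G \<subseteq> ?F"
    using N by auto
  moreover have "inj_on (\<lambda>m. (m + m0) mod int N) ?G"
    using bij_betw_shift_residues[OF N, of m0] by (auto simp: bij_betw_def inj_on_def)
  ultimately have "card ?G \<le> card ?F"
    by (intro card_inj_on_le) auto
  moreover have "card ?F + card ?G = card (residues_below N)"
  proof -
    have "?F \<union> ?G = residues_below N" by blast
    then show ?thesis by (subst card_Un_disjoint[symmetric]) auto
  qed
  ultimately show ?thesis by simp
qed

text \<open>Double counting of pairs \<open>(m, q)\<close>: each \<open>q\<close> is far for at
  least half of all multipliers, so one multiplier serves at least half of \<open>Q\<close>.\<close>

lemma ex_common_multiplier: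
  assumes N: "0 < N" and Q: "finite Q" "\<And>q. q \<in> Q \<Longrightarrow> \<not> int N dvd v q"
  shows "\<exists>m\<in>residues_below N. card Q \<le> 2 * card {q \<in> Q. far_from_zero N (m * v q)}"
proof (rule ccontr)
  let ?Z = "residues_below N"
  assume "\<not> ?thesis"
  then have "2 * card {q \<in> Q. far_from_zero N (m * v q)} < card Q" if "m \<in> ?Z" for m
    using that by auto
  then have "(\<Sum>m\<in>?Z. 2 * card {q \<in> Q. far_from_zero N (m * v q)}) < (\<Sum>m\<in>?Z. card Q)"
    using N by (intro sum_strict_mono) (auto simp: residues_below_def)
  also have "\<dots> = (\<Sum>q\<in>Q. N)" by simp
  also have "\<dots> \<le> (\<Sum>q\<in>Q. 2 * card {m \<in> ?Z. far_from_zero N (m * v q)})"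
    using half_multipliers_far[OF N] Q by (intro sum_mono) auto
  also have "\<dots> = 2 * (\<Sum>q\<in>Q. \<Sum>m\<in>?Z. of_bool (far_from_zero N (m * v q)))"
    by (simp add: sum_distrib_left Int_def)
  also have "\<dots> = 2 * (\<Sum>m\<in>?Z. \<Sum>q\<in>Q. of_bool (far_from_zero N (m * v q)))"
    by (subst sum.swap) simp
  also have "\<dots> = (\<Sum>m\<in>?Z. 2 * card {q \<in> Q. far_from_zero N (m * v q)})"
    using Q by (simp add: sum_distrib_left Int_def)
  finally show False by simp
qed

text \<open>For positive \<open>N\<close>, the index of the arc of length \<open>N / 150\<close>
  containing \<open>v\<close>. Reducing it modulo 150 makes it depend on \<open>v\<close> modulo
  \<open>N\<close> only.\<close>

definition rounded :: "nat \<Rightarrow> int \<Rightarrow> int" where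
  "rounded N v = (150 * v) div int N mod 150"

text \<open>A quadruple of forced values involves 12 rounded values, each with error at most 1. Distance
  \<open>N / 6\<close> from \<open>N\<int>\<close> becomes distance 25 after rounding, which exceeds twice that error.\<close>
definition far_mod_150 :: "int \<Rightarrow> bool" where
  "far_mod_150 t \<longleftrightarrow> (\<forall>z. 12 < \<bar>t - 150 * z\<bar>)"

lemma rounded_range: "rounded N v \<in> {0..<150}"
  by (simp add: rounded_def)

text \<open>The integer \<open>t\<close> approximates \<open>150 v / N\<close> modulo 150, with error at most \<open>e\<close>.\<close>
definition approximates :: "nat \<Rightarrow> int \<Rightarrow> int \<Rightarrow> int \<Rightarrow> bool" where
  "approximates N e t v \<longleftrightarrow> (\<exists>z. \<bar>int N * t - 150 * v - 150 * int N * z\<bar> \<le> int N * e)"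

lemma approximates_rounded:
  assumes "0 < N" shows "approximates N 1 (rounded N v) v"
proof -
  let ?q = "(150 * v) div int N"
  have "rounded N v = ?q - 150 * (?q div 150)"
    by (simp add: rounded_def minus_mult_div_eq_mod)
  moreover have "int N * ?q = 150 * v - (150 * v) mod int N"
    by (simp add: minus_mod_eq_mult_div)
  moreover have "n * r - 150 * v - 150 * n * (- k) = - m"
    if "r = q - 150 * k" "n * q = 150 * v - m" for n r q k m
  proof -
    have "n * r = n * q - 150 * n * k" unfolding that(1) by (simp add: right_diff_distrib)
    then show ?thesis using that(2) by simp
  qed
  ultimately have "int N * rounded N v - 150 * v - 150 * int N * (- (?q div 150)) = - ((150 * v) mod int N)"
    by blast
  moreover have "\<bar>- ((150 * v) mod int N)\<bar> \<le> int N * 1"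
    using assms pos_mod_bound[of "int N" "150 * v"] pos_mod_sign[of "int N" "150 * v"] by linarith
  ultimately show ?thesis unfolding approximates_def by metis
qed

lemma approximates_add:
  assumes "approximates N e t v" "approximates N e' t' v'"
  shows "approximates N (e + e') (t + t') (v + v')"
proof -
  obtain z z' where "\<bar>int N * t - 150 * v - 150 * int N * z\<bar> \<le> int N * e"
    "\<bar>int N * t' - 150 * v' - 150 * int N * z'\<bar> \<le> int N * e'"
    using assms by (auto simp: approximates_def)
  then have "\<bar>int N * (t + t') - 150 * (v + v') - 150 * int N * (z + z')\<bar> \<le> int N * (e + e')"
    by (simp add: algebra_simps)
  then show ?thesis by (auto simp: approximates_def)
qed

lemma approximates_diff:
  assumes "approximates N e t v" "approximates N e' t' v'"
  shows "approximates N (e + e') (t - t') (v - v')"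
proof -
  obtain z z' where "\<bar>int N * t - 150 * v - 150 * int N * z\<bar> \<le> int N * e"
    "\<bar>int N * t' - 150 * v' - 150 * int N * z'\<bar> \<le> int N * e'"
    using assms by (auto simp: approximates_def)
  then have "\<bar>int N * (t - t') - 150 * (v - v') - 150 * int N * (z - z')\<bar> \<le> int N * (e + e')"
    by (simp add: algebra_simps)
  then show ?thesis by (auto simp: approximates_def)
qed

text \<open>Soundness of the rounded test: total error at most 12 never makes a combination that
  vanishes modulo \<open>N\<close> look far.\<close>

lemma not_far_mod_150:
  assumes "0 < N" "approximates N e t v" "e \<le> 12" "int N dvd v"
  shows "\<not> far_mod_150 t"
proof -
  obtain w where w: "v = int N * w" using assms(4) by blast
  obtain z where "\<bar>int N * t - 150 * v - 150 * int N * z\<bar> \<le> int N * e"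
    using assms(2) by (auto simp: approximates_def)
  then have "\<bar>int N * (t - 150 * (w + z))\<bar> \<le> int N * e"
    by (simp add: w algebra_simps)
  then have "int N * \<bar>t - 150 * (w + z)\<bar> \<le> int N * e" by (simp add: abs_mult)
  then have "\<bar>t - 150 * (w + z)\<bar> \<le> e" using assms(1) by simp
  then show ?thesis using assms(3) unfolding far_mod_150_def by (metis linorder_not_less order_trans)
qed

text \<open>Completeness of the rounded test: distance \<open>N / 6\<close> scales to 25, and an
  error of at most 12 leaves at least 13.\<close>

lemma far_mod_150I:
  assumes "0 < N" "approximates N e t v" "e \<le> 12" "far_from_zero N v"
  shows "far_mod_150 t"
  unfolding far_mod_150_def
proof
  fix y
  obtain z where z: "\<bar>int N * t - 150 * v - 150 * int N * z\<bar> \<le> int N * e"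
    using assms(2) by (auto simp: approximates_def)
  have "int N \<le> 6 * \<bar>v - int N * (y - z)\<bar>"
    using assms(4) by (auto simp: far_from_zero_def)
  \<comment> \<open>The triangle inequality: \<open>150 * (v - int N * (y - z))\<close> is the
    difference of the two quantities on the right.\<close>
  moreover have "25 * (6 * \<bar>v - int N * (y - z)\<bar>) \<le> \<bar>int N * t - 150 * v - 150 * int N * z\<bar> + \<bar>int N * (t - 150 * y)\<bar>"
    by (simp add: algebra_simps abs_if)
  moreover have "int N * e \<le> int N * 12" using assms by (intro mult_left_mono) auto
  ultimately have "int N * 13 \<le> int N * \<bar>t - 150 * y\<bar>"
    using z by (simp add: abs_mult)
  then show "12 < \<bar>t - 150 * y\<bar>" using assms(1) by simp
qed

section \<open>Approximately additive maps\<close>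

lemma ex_card_fibre_le:
  fixes c :: real
  assumes "finite X" "finite Y" "Y \<noteq> {}"
    and "card {(x, y). x \<in> X \<and> y \<in> Y \<and> R x y} \<le> c * card Y"
  shows "\<exists>y\<in>Y. card {x \<in> X. R x y} \<le> c"
proof (rule ccontr)
  assume "\<not> ?thesis"
  then have "(\<Sum>y\<in>Y. c) < (\<Sum>y\<in>Y. real (card {x \<in> X. R x y}))"
    using assms(2,3) by (intro sum_strict_mono) auto
  also have "\<dots> = card (SIGMA y:Y. {x \<in> X. R x y})"
    using assms(1,2) by simp
  also have "(SIGMA y:Y. {x \<in> X. R x y}) = prod.swap ` {(x, y). x \<in> X \<and> y \<in> Y \<and> R x y}"
    by force
  also have "card \<dots> = card {(x, y). x \<in> X \<and> y \<in> Y \<and> R x y}"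
    by (intro card_image) simp
  finally show False using assms(4) by (simp add: mult.commute)
qed

text \<open>Every difference \<open>\<Phi> (x + d) - \<Phi> x\<close> takes a popular value \<open>r d\<close>: for random \<open>x, y, u\<close> the
  quadruples \<open>(x + d, u, y + d, x + u - y)\<close> and \<open>(x, u, y, x + u - y)\<close> are both uniformly
  distributed.\<close>
lemma mostly_additive_imp_mostly_affine:
  fixes \<Phi> :: "int \<Rightarrow> int" and \<eta> :: real and N :: nat
  defines "Z \<equiv> residues_below N"
  assumes N: "0 < N" and \<eta>: "6 * \<eta> < 1"
    and bad: "card {(x, y, z). x \<in> Z \<and> y \<in> Z \<and> z \<in> Z \<and>
      \<not> int N dvd \<Phi> x + \<Phi> y - \<Phi> z - \<Phi> ((x + y - z) mod int N)} \<le> \<eta> * real N ^ 3"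
  shows "\<exists>r\<in>Z. \<exists>s\<in>Z. card {x \<in> Z. \<not> int N dvd \<Phi> x - (r * x + s)} \<le> 2 * \<eta> * N"
proof -
  let ?n = "int N"
  define Bad where "Bad = {(x, y, z). x \<in> Z \<and> y \<in> Z \<and> z \<in> Z \<and>
      \<not> ?n dvd \<Phi> x + \<Phi> y - \<Phi> z - \<Phi> ((x + y - z) mod ?n)}"
  \<comment> \<open>The discrete derivative of \<open>\<Phi>\<close> in direction \<open>d\<close>;
    \<open>P d\<close> collects the pairs of points at which it disagrees.\<close>
  define D where "D d x = \<Phi> ((x + d) mod ?n) - \<Phi> x" for d x
  define P where "P d = {(x, y). x \<in> Z \<and> y \<in> Z \<and> \<not> ?n dvd D d x - D d y}" for d
  have fin: "finite Z" "card Z = N" "Z \<noteq> {}" "finite Bad"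
    using N unfolding Z_def Bad_def
    by (auto simp: residues_below_def intro: finite_subset[of _ "{0..<?n} \<times> {0..<?n} \<times> {0..<?n}"])
  have finP: "finite (P d)" for d
    unfolding P_def using fin by (auto intro: finite_subset[of _ "Z \<times> Z"])
  have inj: "inj_on (\<lambda>x. (x + d) mod ?n) Z" and inZ: "x mod ?n \<in> Z" for d x
    using bij_betw_shift_residues[OF N, of d] N unfolding Z_def by (auto simp: bij_betw_def)
  have P: "card (P d) \<le> 2 * \<eta> * N * N" for d
  proof -
    let ?f = "\<lambda>((x, y), u). ((x + d) mod ?n, u, (y + d) mod ?n)"
    let ?g = "\<lambda>((x, y), u). (x, u, y)"
    \<comment> \<open>If neither quadruple were violated, subtracting the two relations would cancel
      \<open>\<Phi> u\<close> and the common last term, making the derivatives at \<open>x\<close>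
      and \<open>y\<close> agree.\<close>
    have "P d \<times> Z \<subseteq> {t \<in> P d \<times> Z. ?f t \<in> Bad} \<union> {t \<in> P d \<times> Z. ?g t \<in> Bad}"
    proof (rule subsetI, rule ccontr)
      fix t assume "t \<in> P d \<times> Z"
        and t: "t \<notin> {t \<in> P d \<times> Z. ?f t \<in> Bad} \<union> {t \<in> P d \<times> Z. ?g t \<in> Bad}"
      then obtain x y u where xy: "(x, y) \<in> P d" and u: "u \<in> Z" and "t = ((x, y), u)"
        by auto
      with t have no: "?f ((x, y), u) \<notin> Bad" "?g ((x, y), u) \<notin> Bad"
        by auto
      have xyZ: "x \<in> Z" "y \<in> Z" using xy by (auto simp: P_def)
      have arg: "((x + d) mod ?n + u - (y + d) mod ?n) mod ?n = (x + u - y) mod ?n"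
      proof -
        have "((x + d) mod ?n + (u - (y + d) mod ?n)) mod ?n = ((x + d) + (u - (y + d))) mod ?n"
          by (metis mod_add_left_eq mod_add_right_eq mod_diff_right_eq)
        then show ?thesis by (simp add: algebra_simps)
      qed
      have "?n dvd \<Phi> ((x + d) mod ?n) + \<Phi> u - \<Phi> ((y + d) mod ?n) - \<Phi> ((x + u - y) mod ?n)"
        using no(1) u inZ unfolding Bad_def by (auto simp: arg)
      moreover have "?n dvd \<Phi> x + \<Phi> u - \<Phi> y - \<Phi> ((x + u - y) mod ?n)"
        using no(2) u xyZ unfolding Bad_def by auto
      ultimately have "?n dvd (\<Phi> ((x + d) mod ?n) + \<Phi> u - \<Phi> ((y + d) mod ?n) - \<Phi> ((x + u - y) mod ?n))
          - (\<Phi> x + \<Phi> u - \<Phi> y - \<Phi> ((x + u - y) mod ?n))" by (rule dvd_diff)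
      then have "?n dvd D d x - D d y" unfolding D_def by (simp add: algebra_simps)
      then show False using xy by (simp add: P_def)
    qed
    then have "card (P d \<times> Z) \<le> card {t \<in> P d \<times> Z. ?f t \<in> Bad} + card {t \<in> P d \<times> Z. ?g t \<in> Bad}"
      using fin finP by (intro order_trans[OF card_mono card_Un_le]) auto
    moreover have "card {t \<in> P d \<times> Z. ?f t \<in> Bad} \<le> card Bad"
    proof (rule card_inj_on_le[of ?f])
      show "inj_on ?f {t \<in> P d \<times> Z. ?f t \<in> Bad}"
        using inj[of d] unfolding P_def by (auto simp: inj_on_def)
    qed (use fin in auto)
    moreover have "card {t \<in> P d \<times> Z. ?g t \<in> Bad} \<le> card Bad"
      by (rule card_inj_on_le[of ?g]) (use fin in \<open>auto simp: inj_on_def\<close>)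
    ultimately have "card (P d) * N \<le> 2 * card Bad"
      using fin by (simp add: card_cartesian_product)
    then have "real (card (P d)) * N \<le> 2 * real (card Bad)"
      by (metis of_nat_le_iff of_nat_mult of_nat_numeral)
    also have "\<dots> \<le> 2 * (\<eta> * real N ^ 3)"
      using bad unfolding Bad_def[symmetric] by simp
    finally have "real (card (P d)) * N \<le> (2 * \<eta> * N * N) * N"
      by (simp add: power3_eq_cube mult_ac)
    then show ?thesis using N by simp
  qed
  have "\<exists>y\<in>Z. card {x \<in> Z. \<not> ?n dvd D d x - D d y} \<le> 2 * \<eta> * N" for d
    using P[of d] fin unfolding P_def by (intro ex_card_fibre_le) auto
  then obtain y where y: "\<And>d. card {x \<in> Z. \<not> ?n dvd D d x - D d (y d)} \<le> 2 * \<eta> * N"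
    by metis
  define r where "r d = D d (y d)" for d
  have r: "card {x \<in> Z. \<not> ?n dvd D d x - r d} \<le> 2 * \<eta> * N" for d
    using y unfolding r_def .
  \<comment> \<open>Each of three exceptional sets has at most \<open>2 * \<eta> * N\<close>
    elements, so \<open>6 * \<eta> < 1\<close> leaves a point outside all of them, where the
    derivatives along \<open>d\<close>, \<open>e\<close> and \<open>d + e\<close> telescope.\<close>
  have add: "?n dvd r (d + e) - r d - r e" for d e
  proof -
    let ?X1 = "{x \<in> Z. \<not> ?n dvd D d x - r d}"
    let ?X2 = "{x \<in> Z. \<not> ?n dvd D e ((x + d) mod ?n) - r e}"
    let ?X3 = "{x \<in> Z. \<not> ?n dvd D (d + e) x - r (d + e)}"
    have "card ?X2 \<le> card {x \<in> Z. \<not> ?n dvd D e x - r e}"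
    proof (rule card_inj_on_le[of "\<lambda>x. (x + d) mod ?n"])
      show "inj_on (\<lambda>x. (x + d) mod ?n) ?X2" by (rule inj_on_subset[OF inj[of d]]) blast
    qed (use inZ fin in auto)
    then have "real (card ?X2) \<le> 2 * \<eta> * N" using r[of e] by linarith
    then have "real (card ?X1 + card ?X2 + card ?X3) \<le> (6 * \<eta>) * N"
      using r[of d] r[of "d + e"] by simp
    also have "\<dots> < 1 * real N" using \<eta> N by (intro mult_strict_right_mono) auto
    finally have "card ?X1 + card ?X2 + card ?X3 < N" by linarith
    moreover have "card (?X1 \<union> ?X2 \<union> ?X3) \<le> card ?X1 + card ?X2 + card ?X3"
      by (meson add_mono card_Un_le le_refl order_trans)
    ultimately have "card (?X1 \<union> ?X2 \<union> ?X3) < card Z" using fin by simp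
    moreover have "card Z \<le> card (?X1 \<union> ?X2 \<union> ?X3)" if "Z \<subseteq> ?X1 \<union> ?X2 \<union> ?X3"
      by (rule card_mono[OF _ that]) (use fin in auto)
    ultimately have "\<not> Z \<subseteq> ?X1 \<union> ?X2 \<union> ?X3" by linarith
    then obtain x where x: "x \<in> Z" "?n dvd D d x - r d" "?n dvd D e ((x + d) mod ?n) - r e"
      "?n dvd D (d + e) x - r (d + e)" by auto
    have "((x + d) mod ?n + e) mod ?n = (x + (d + e)) mod ?n"
      by (simp add: mod_simps algebra_simps)
    then have "D (d + e) x = D e ((x + d) mod ?n) + D d x"
      unfolding D_def by simp
    then have "r (d + e) - r d - r e = (D d x - r d) + (D e ((x + d) mod ?n) - r e) - (D (d + e) x - r (d + e))"
      by simp
    then show ?thesis using x by (metis dvd_add dvd_diff)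
  qed
  have lin: "?n dvd r (int k) - int k * r 1" for k
  proof (induction k)
    case 0
    then show ?case using add[of 0 0] by simp
  next
    case (Suc k)
    have "r (int (Suc k)) - int (Suc k) * r 1 = (r (int k + 1) - r (int k) - r 1) + (r (int k) - int k * r 1)"
      by (simp add: algebra_simps)
    then show ?case using add[of "int k" 1] Suc by (metis dvd_add)
  qed
  have lin: "?n dvd r d - d * r 1" if "d \<in> Z" for d
    using lin[of "nat d"] that by (simp add: Z_def residues_below_def)
  have lin': "{x \<in> Z. \<not> ?n dvd D d x - d * r 1} \<subseteq> {x \<in> Z. \<not> ?n dvd D d x - r d}" if "d \<in> Z" for d
  proof clarify
    fix x assume "?n dvd D d x - r d" "\<not> ?n dvd D d x - d * r 1"
    moreover have "D d x - d * r 1 = (D d x - r d) + (r d - d * r 1)" by simp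
    ultimately show False using lin[OF that] by (metis dvd_add)
  qed
  \<comment> \<open>Averaging over the base point: some \<open>x0\<close> satisfies
    \<open>D d x0 = d * r 1\<close> modulo \<open>N\<close> for nearly all \<open>d\<close>, so
    \<open>\<Phi>\<close> is affine at nearly all points \<open>x0 + d\<close>.\<close>
  have "card {(d, x). d \<in> Z \<and> x \<in> Z \<and> \<not> ?n dvd D d x - d * r 1} \<le> 2 * \<eta> * N * card Z"
  proof -
    have "{(d, x). d \<in> Z \<and> x \<in> Z \<and> \<not> ?n dvd D d x - d * r 1} = (SIGMA d:Z. {x \<in> Z. \<not> ?n dvd D d x - d * r 1})"
      by auto
    then have "real (card {(d, x). d \<in> Z \<and> x \<in> Z \<and> \<not> ?n dvd D d x - d * r 1}) = (\<Sum>d\<in>Z. real (card {x \<in> Z. \<not> ?n dvd D d x - d * r 1}))"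
      using fin by simp
    also have "\<dots> \<le> (\<Sum>d\<in>Z. 2 * \<eta> * N)"
    proof (intro sum_mono)
      fix d assume "d \<in> Z"
      then have "card {x \<in> Z. \<not> ?n dvd D d x - d * r 1} \<le> card {x \<in> Z. \<not> ?n dvd D d x - r d}"
        using lin' fin by (intro card_mono) auto
      then show "real (card {x \<in> Z. \<not> ?n dvd D d x - d * r 1}) \<le> 2 * \<eta> * N"
        using r[of d] by linarith
    qed
    finally show ?thesis by (simp add: mult_ac)
  qed
  then obtain x0 where x0: "x0 \<in> Z" "card {d \<in> Z. \<not> ?n dvd D d x0 - d * r 1} \<le> 2 * \<eta> * N"
    using ex_card_fibre_le[of Z Z "\<lambda>d x. \<not> ?n dvd D d x - d * r 1" "2 * \<eta> * N"] fin by auto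
  define r0 where "r0 = r 1 mod ?n"
  define s0 where "s0 = (\<Phi> x0 - r 1 * x0) mod ?n"
  have "card {x \<in> Z. \<not> ?n dvd \<Phi> x - (r0 * x + s0)} \<le> card {d \<in> Z. \<not> ?n dvd D d x0 - d * r 1}"
  proof (rule card_inj_on_le[of "\<lambda>x. (x + (- x0)) mod ?n"])
    show "inj_on (\<lambda>x. (x + (- x0)) mod ?n) {x \<in> Z. \<not> ?n dvd \<Phi> x - (r0 * x + s0)}"
      using inj[of "- x0"] by (auto simp: inj_on_def)
    show "(\<lambda>x. (x + - x0) mod ?n) ` {x \<in> Z. \<not> ?n dvd \<Phi> x - (r0 * x + s0)}
      \<subseteq> {d \<in> Z. \<not> ?n dvd D d x0 - d * r 1}"
    proof (clarsimp simp: inZ)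
      fix x assume x: "x \<in> Z" "\<not> ?n dvd \<Phi> x - (r0 * x + s0)"
        and dv: "?n dvd D ((x - x0) mod ?n) x0 - (x - x0) mod ?n * r 1"
      have "(x0 + (x - x0) mod ?n) mod ?n = x mod ?n" by (simp add: mod_simps)
      also have "\<dots> = x" using x by (simp add: Z_def residues_below_def)
      finally have D: "D ((x - x0) mod ?n) x0 = \<Phi> x - \<Phi> x0" unfolding D_def by simp
      have "[\<Phi> x - \<Phi> x0 = (x - x0) mod ?n * r 1] (mod ?n)"
        using dv unfolding D cong_iff_dvd_diff .
      also have "[(x - x0) mod ?n * r 1 = (x - x0) * r 1] (mod ?n)"
        by (simp add: cong_def mod_simps)
      finally have 1: "[\<Phi> x - \<Phi> x0 = (x - x0) * r 1] (mod ?n)" .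
      have "[r0 * x + s0 = r 1 * x + (\<Phi> x0 - r 1 * x0)] (mod ?n)"
        unfolding r0_def s0_def by (intro cong_add cong_mult cong_refl) (simp_all add: cong_def)
      then have "[\<Phi> x - (r0 * x + s0) = \<Phi> x - (r 1 * x + (\<Phi> x0 - r 1 * x0))] (mod ?n)"
        by (intro cong_diff cong_refl)
      moreover have "\<Phi> x - (r 1 * x + (\<Phi> x0 - r 1 * x0)) = \<Phi> x - \<Phi> x0 - (x - x0) * r 1"
        by (simp add: algebra_simps)
      ultimately have "?n dvd \<Phi> x - (r0 * x + s0)"
        using 1 by (metis cong_dvd_iff cong_iff_dvd_diff)
      with x show False by simp
    qed
  qed (use fin in auto)
  then have "card {x \<in> Z. \<not> ?n dvd \<Phi> x - (r0 * x + s0)} \<le> 2 * \<eta> * N"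
    using x0 by linarith
  then show ?thesis using inZ unfolding r0_def s0_def by blast
qed

section \<open>Janson's inequality for additive triples and quadruples\<close>

text \<open>The target in \<open>E\<close> and two entries determine a triple. Hence at most
  \<open>3 |E| N\<close>, \<open>9 |E|\<close> and 27 triples have one, two or three prescribed
  entries in a given three-element set. With weights \<open>p\<^sup>2\<close>, \<open>p\<close>, 1
  and three choices of position in the first two cases, this gives the \<open>\<delta>\<close> of
  \<open>Janson_uniform\<close>.\<close>

lemma Janson_triples:
  fixes F :: "(int \<times> int \<times> int) set" and p \<mu> :: real
  assumes p: "0 \<le> p" "p \<le> 1" and S: "S \<subseteq> residues_below N" and E: "finite E"
    and F: "F \<subseteq> {(b, c, d). b \<in> S \<and> c \<in> S \<and> d \<in> S \<and> b \<noteq> c \<and> b \<noteq> d \<and> c \<noteq> d \<and> (c + d - b) mod int N \<in> E}"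
    and \<mu>: "\<mu> \<le> card F * p ^ 3"
  shows "subset_expectation p S (\<lambda>A. of_bool (\<forall>(b, c, d)\<in>F. \<not> {b, c, d} \<subseteq> A))
    \<le> exp (- \<mu> / (4 * (9 * real (card E) * (N * p\<^sup>2) + 27 * real (card E) * p + 27)))"
proof -
  let ?T = "\<lambda>(b, c, d). {b, c, d} :: int set"
  let ?Z = "residues_below N"
  have finS: "finite S" by (rule finite_subset[OF S]) simp
  have finF: "finite F"
    by (rule finite_subset[of _ "S \<times> S \<times> S"]) (use F finS in auto)
  have sum_le: "(\<Sum>j | j \<in> F \<and> ?T j \<inter> U \<noteq> {}. p ^ card (?T j - U))
      \<le> 9 * real (card E) * (N * p\<^sup>2) + 27 * real (card E) * p + 27" if "card U = 3" for U
  proof -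
    have finU: "finite U" using that by (metis card.infinite zero_neq_numeral)
    define C where "C R = real (card {t \<in> F. R t})" for R
    have b: "C R \<le> card X" if "\<And>t. t \<in> F \<Longrightarrow> R t \<Longrightarrow> h t \<in> X" "inj_on h F" "finite X"
      for R :: "int \<times> int \<times> int \<Rightarrow> bool" and h :: "int \<times> int \<times> int \<Rightarrow> int \<times> int \<times> int" and X
      unfolding C_def of_nat_le_iff
      by (rule card_inj_on_le[of h]) (use that in \<open>auto simp: inj_on_def\<close>)
    let ?a = "\<lambda>b c d. (c + d - b) mod int N"
    have F1: "(b, c, d) \<in> F \<Longrightarrow> b \<in> ?Z \<and> c \<in> ?Z \<and> d \<in> ?Z \<and> ?a b c d \<in> E" for b c d
      using F S by auto
    have inj1: "inj_on (\<lambda>(b, c, d). (b, c, ?a b c d)) F"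
      and inj2: "inj_on (\<lambda>(b, c, d). (b, d, ?a b c d)) F"
      and inj3: "inj_on (\<lambda>(b, c, d). (c, d, ?a b c d)) F"
      by (auto simp: inj_on_def mod_eq_dvd_iff dvd_diff_commute dest!: F1 intro: residues_below_eqI)
    have single: "C (\<lambda>(b, c, d). b \<in> U) \<le> 3 * card E * N" "C (\<lambda>(b, c, d). c \<in> U) \<le> 3 * card E * N"
      "C (\<lambda>(b, c, d). d \<in> U) \<le> 3 * card E * N"
      using b[of "\<lambda>(b, c, d). b \<in> U", OF _ inj1, of "U \<times> ?Z \<times> E"]
        b[of "\<lambda>(b, c, d). c \<in> U", OF _ inj1, of "?Z \<times> U \<times> E"]
        b[of "\<lambda>(b, c, d). d \<in> U", OF _ inj2, of "?Z \<times> U \<times> E"] that finU E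
      by (auto simp: card_cartesian_product mult_ac dest: F1)
    have double: "C (\<lambda>(b, c, d). b \<in> U \<and> c \<in> U) \<le> 9 * card E" "C (\<lambda>(b, c, d). b \<in> U \<and> d \<in> U) \<le> 9 * card E"
      "C (\<lambda>(b, c, d). c \<in> U \<and> d \<in> U) \<le> 9 * card E"
      using b[of "\<lambda>(b, c, d). b \<in> U \<and> c \<in> U", OF _ inj1, of "U \<times> U \<times> E"]
        b[of "\<lambda>(b, c, d). b \<in> U \<and> d \<in> U", OF _ inj2, of "U \<times> U \<times> E"]
        b[of "\<lambda>(b, c, d). c \<in> U \<and> d \<in> U", OF _ inj3, of "U \<times> U \<times> E"] that finU E
      by (auto simp: card_cartesian_product mult_ac dest: F1)
    have triple: "C (\<lambda>(b, c, d). b \<in> U \<and> c \<in> U \<and> d \<in> U) \<le> 27"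
      using b[of "\<lambda>(b, c, d). b \<in> U \<and> c \<in> U \<and> d \<in> U" id "U \<times> U \<times> U"] that finU
      by (auto simp: card_cartesian_product)
    \<comment> \<open>A triple with exactly \<open>k\<close> entries in \<open>U\<close> has weight
      \<open>p ^ (3 - k)\<close>, and the summand for those \<open>k\<close> positions already
      covers it.\<close>
    have term_le: "of_bool (?T (b, c, d) \<inter> U \<noteq> {}) * p ^ card (?T (b, c, d) - U) \<le>
        p\<^sup>2 * (of_bool (b \<in> U) + of_bool (c \<in> U) + of_bool (d \<in> U))
        + p * (of_bool (b \<in> U \<and> c \<in> U) + of_bool (b \<in> U \<and> d \<in> U) + of_bool (c \<in> U \<and> d \<in> U))
        + of_bool (b \<in> U \<and> c \<in> U \<and> d \<in> U)" if "(b, c, d) \<in> F" for b c d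
    proof -
      have "b \<noteq> c" "b \<noteq> d" "c \<noteq> d" using F that by auto
      then show ?thesis
        using p by (cases "b \<in> U"; cases "c \<in> U"; cases "d \<in> U")
          (simp_all add: insert_Diff_if numeral_2_eq_2)
    qed
    have "(\<Sum>j | j \<in> F \<and> ?T j \<inter> U \<noteq> {}. p ^ card (?T j - U)) =
        (\<Sum>j\<in>F. of_bool (?T j \<inter> U \<noteq> {}) * p ^ card (?T j - U))"
      using finF by (intro sum.mono_neutral_cong_left) auto
    also have "\<dots> \<le> (\<Sum>(b, c, d)\<in>F. p\<^sup>2 * (of_bool (b \<in> U) + of_bool (c \<in> U) + of_bool (d \<in> U))
        + p * (of_bool (b \<in> U \<and> c \<in> U) + of_bool (b \<in> U \<and> d \<in> U) + of_bool (c \<in> U \<and> d \<in> U))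
        + of_bool (b \<in> U \<and> c \<in> U \<and> d \<in> U))"
      using term_le by (intro sum_mono) (simp only: split_paired_all split)
    also have "\<dots> = p\<^sup>2 * (C (\<lambda>(b, c, d). b \<in> U) + C (\<lambda>(b, c, d). c \<in> U) + C (\<lambda>(b, c, d). d \<in> U))
        + p * (C (\<lambda>(b, c, d). b \<in> U \<and> c \<in> U) + C (\<lambda>(b, c, d). b \<in> U \<and> d \<in> U) + C (\<lambda>(b, c, d). c \<in> U \<and> d \<in> U))
        + C (\<lambda>(b, c, d). b \<in> U \<and> c \<in> U \<and> d \<in> U)"
    proof -
      have C: "C R = (\<Sum>t\<in>F. of_bool (R t))" for R
        using finF by (simp add: C_def Int_def)
      show ?thesis
        unfolding C by (simp only: case_prod_unfold sum.distrib sum_distrib_left[symmetric])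
    qed
    also have "\<dots> \<le> p\<^sup>2 * (3 * (3 * card E * N)) + p * (3 * (9 * card E)) + 27"
      using single double triple p by (intro add_mono mult_left_mono) auto
    finally show ?thesis by (simp add: mult_ac)
  qed
  have "subset_expectation p S (\<lambda>A. of_bool (\<forall>i\<in>F. \<not> ?T i \<subseteq> A))
    \<le> exp (- \<mu> / (4 * (9 * real (card E) * (N * p\<^sup>2) + 27 * real (card E) * p + 27)))"
  proof (rule Janson_uniform[OF finS p finF])
    fix i assume i: "i \<in> F"
    then show "?T i \<subseteq> S" using F by auto
    have "card (?T i) = 3" using F i by auto
    then show "(\<Sum>j | j \<in> F \<and> ?T j \<inter> ?T i \<noteq> {}. p ^ card (?T j - ?T i))
      \<le> 9 * real (card E) * (N * p\<^sup>2) + 27 * real (card E) * p + 27" by (rule sum_le)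
  next
    show "0 < 9 * real (card E) * (N * p\<^sup>2) + 27 * real (card E) * p + 27"
      using p by (simp add: add_nonneg_pos)
    have "(\<Sum>i\<in>F. p ^ card (?T i)) = (\<Sum>i\<in>F. p ^ 3)"
    proof (intro sum.cong refl)
      fix i assume "i \<in> F"
      then have "card (?T i) = 3" using F by auto
      then show "p ^ card (?T i) = p ^ 3" by simp
    qed
    then show "\<mu> \<le> (\<Sum>i\<in>F. p ^ card (?T i))" using \<mu> by simp
  qed
  then show ?thesis by (simp only: case_prod_unfold)
qed

text \<open>As for triples: any three entries determine the fourth. Prescribing one, two, three or
  four entries in a four-element set leaves at most \<open>4 N\<^sup>2\<close>, \<open>16 N\<close>,
  64 or 256 quadruples, with 4, 6, 4 and 1 choices of positions.\<close>

lemma Janson_quadruples: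
  fixes F :: "(int \<times> int \<times> int \<times> int) set" and p \<mu> :: real
  assumes p: "0 \<le> p" "p \<le> 1" and S: "S \<subseteq> residues_below N"
    and F: "F \<subseteq> {(x, y, z, w). x \<in> S \<and> y \<in> S \<and> z \<in> S \<and> w \<in> S \<and> distinct [x, y, z, w] \<and> int N dvd x + y - z - w}"
    and \<mu>: "\<mu> \<le> card F * p ^ 4"
  shows "subset_expectation p S (\<lambda>A. of_bool (\<forall>(x, y, z, w)\<in>F. \<not> {x, y, z, w} \<subseteq> A))
    \<le> exp (- \<mu> / (4 * (16 * ((real N)\<^sup>2 * p ^ 3) + 96 * (N * p\<^sup>2) + 256 * p + 256)))"
proof -
  let ?T = "\<lambda>(x, y, z, w). {x, y, z, w} :: int set"
  let ?Z = "residues_below N"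
  have finS: "finite S" by (rule finite_subset[OF S]) simp
  have finF: "finite F"
    by (rule finite_subset[of _ "S \<times> S \<times> S \<times> S"]) (use F finS in auto)
  have sum_le: "(\<Sum>j | j \<in> F \<and> ?T j \<inter> U \<noteq> {}. p ^ card (?T j - U))
      \<le> 16 * ((real N)\<^sup>2 * p ^ 3) + 96 * (N * p\<^sup>2) + 256 * p + 256" if "card U = 4" for U
  proof -
    have finU: "finite U" using that by (metis card.infinite zero_neq_numeral)
    define C where "C R = real (card {t \<in> F. R t})" for R
    have b: "C R \<le> card X" if "\<And>t. t \<in> F \<Longrightarrow> R t \<Longrightarrow> h t \<in> X" "inj_on h F" "finite X"
      for R :: "int \<times> int \<times> int \<times> int \<Rightarrow> bool" and h :: "int \<times> int \<times> int \<times> int \<Rightarrow> 'b" and X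
      unfolding C_def of_nat_le_iff
      by (rule card_inj_on_le[of h]) (use that in \<open>auto simp: inj_on_def\<close>)
    have F1: "(x, y, z, w) \<in> F \<Longrightarrow> x \<in> ?Z \<and> y \<in> ?Z \<and> z \<in> ?Z \<and> w \<in> ?Z" for x y z w
      using F S by auto
    have dv: "int N dvd x + y - z - w" if "(x, y, z, w) \<in> F" for x y z w using that F by auto
    have inj1: "inj_on (\<lambda>(x, y, z, w). (x, y, z)) F"
    proof (rule inj_onI, clarsimp)
      fix x y z w w' assume "(x, y, z, w) \<in> F" "(x, y, z, w') \<in> F"
      then show "w = w'"
        using dvd_diff[OF dv dv, of x y z w' x y z w] by (auto intro!: residues_below_eqI dest: F1)
    qed
    have inj2: "inj_on (\<lambda>(x, y, z, w). (x, y, w)) F"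
    proof (rule inj_onI, clarsimp)
      fix x y z z' w assume "(x, y, z, w) \<in> F" "(x, y, z', w) \<in> F"
      then show "z = z'"
        using dvd_diff[OF dv dv, of x y z' w x y z w] by (auto intro!: residues_below_eqI dest: F1)
    qed
    have inj3: "inj_on (\<lambda>(x, y, z, w). (x, z, w)) F"
    proof (rule inj_onI, clarsimp)
      fix x y y' z w assume "(x, y, z, w) \<in> F" "(x, y', z, w) \<in> F"
      then show "y = y'"
        using dvd_diff[OF dv dv, of x y z w x y' z w] by (auto intro!: residues_below_eqI dest: F1)
    qed
    have inj4: "inj_on (\<lambda>(x, y, z, w). (y, z, w)) F"
    proof (rule inj_onI, clarsimp)
      fix x x' y z w assume "(x, y, z, w) \<in> F" "(x', y, z, w) \<in> F"
      then show "x = x'"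
        using dvd_diff[OF dv dv, of x y z w x' y z w] by (auto intro!: residues_below_eqI dest: F1)
    qed
    have single: "C (\<lambda>(x, y, z, w). x \<in> U) \<le> 4 * N\<^sup>2" "C (\<lambda>(x, y, z, w). y \<in> U) \<le> 4 * N\<^sup>2"
      "C (\<lambda>(x, y, z, w). z \<in> U) \<le> 4 * N\<^sup>2" "C (\<lambda>(x, y, z, w). w \<in> U) \<le> 4 * N\<^sup>2"
      using b[of "\<lambda>(x, y, z, w). x \<in> U", OF _ inj1, of "U \<times> ?Z \<times> ?Z"]
        b[of "\<lambda>(x, y, z, w). y \<in> U", OF _ inj1, of "?Z \<times> U \<times> ?Z"]
        b[of "\<lambda>(x, y, z, w). z \<in> U", OF _ inj1, of "?Z \<times> ?Z \<times> U"]
        b[of "\<lambda>(x, y, z, w). w \<in> U", OF _ inj2, of "?Z \<times> ?Z \<times> U"] that finU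
      by (auto simp: card_cartesian_product mult_ac power2_eq_square dest: F1)
    have double: "C (\<lambda>(x, y, z, w). x \<in> U \<and> y \<in> U) \<le> 16 * N" "C (\<lambda>(x, y, z, w). x \<in> U \<and> z \<in> U) \<le> 16 * N"
      "C (\<lambda>(x, y, z, w). y \<in> U \<and> z \<in> U) \<le> 16 * N" "C (\<lambda>(x, y, z, w). x \<in> U \<and> w \<in> U) \<le> 16 * N"
      "C (\<lambda>(x, y, z, w). y \<in> U \<and> w \<in> U) \<le> 16 * N" "C (\<lambda>(x, y, z, w). z \<in> U \<and> w \<in> U) \<le> 16 * N"
      using b[of "\<lambda>(x, y, z, w). x \<in> U \<and> y \<in> U", OF _ inj1, of "U \<times> U \<times> ?Z"]
        b[of "\<lambda>(x, y, z, w). x \<in> U \<and> z \<in> U", OF _ inj1, of "U \<times> ?Z \<times> U"]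
        b[of "\<lambda>(x, y, z, w). y \<in> U \<and> z \<in> U", OF _ inj1, of "?Z \<times> U \<times> U"]
        b[of "\<lambda>(x, y, z, w). x \<in> U \<and> w \<in> U", OF _ inj2, of "U \<times> ?Z \<times> U"]
        b[of "\<lambda>(x, y, z, w). y \<in> U \<and> w \<in> U", OF _ inj2, of "?Z \<times> U \<times> U"]
        b[of "\<lambda>(x, y, z, w). z \<in> U \<and> w \<in> U", OF _ inj3, of "?Z \<times> U \<times> U"] that finU
      by (auto simp: card_cartesian_product mult_ac dest: F1)
    have triple: "C (\<lambda>(x, y, z, w). x \<in> U \<and> y \<in> U \<and> z \<in> U) \<le> 64" "C (\<lambda>(x, y, z, w). x \<in> U \<and> y \<in> U \<and> w \<in> U) \<le> 64"
      "C (\<lambda>(x, y, z, w). x \<in> U \<and> z \<in> U \<and> w \<in> U) \<le> 64" "C (\<lambda>(x, y, z, w). y \<in> U \<and> z \<in> U \<and> w \<in> U) \<le> 64"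
      using b[of "\<lambda>(x, y, z, w). x \<in> U \<and> y \<in> U \<and> z \<in> U", OF _ inj1, of "U \<times> U \<times> U"]
        b[of "\<lambda>(x, y, z, w). x \<in> U \<and> y \<in> U \<and> w \<in> U", OF _ inj2, of "U \<times> U \<times> U"]
        b[of "\<lambda>(x, y, z, w). x \<in> U \<and> z \<in> U \<and> w \<in> U", OF _ inj3, of "U \<times> U \<times> U"]
        b[of "\<lambda>(x, y, z, w). y \<in> U \<and> z \<in> U \<and> w \<in> U", OF _ inj4, of "U \<times> U \<times> U"] that finU
      by (auto simp: card_cartesian_product)
    have quad: "C (\<lambda>(x, y, z, w). x \<in> U \<and> y \<in> U \<and> z \<in> U \<and> w \<in> U) \<le> 256"
      using b[of "\<lambda>(x, y, z, w). x \<in> U \<and> y \<in> U \<and> z \<in> U \<and> w \<in> U" id "U \<times> U \<times> U \<times> U"] that finU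
      by (auto simp: card_cartesian_product)
    let ?s1 = "\<lambda>x y z w. of_bool (x \<in> U) + of_bool (y \<in> U) + of_bool (z \<in> U) + of_bool (w \<in> U) :: real"
    let ?s2 = "\<lambda>x y z w. of_bool (x \<in> U \<and> y \<in> U) + of_bool (x \<in> U \<and> z \<in> U) + of_bool (y \<in> U \<and> z \<in> U)
      + of_bool (x \<in> U \<and> w \<in> U) + of_bool (y \<in> U \<and> w \<in> U) + of_bool (z \<in> U \<and> w \<in> U) :: real"
    let ?s3 = "\<lambda>x y z w. of_bool (x \<in> U \<and> y \<in> U \<and> z \<in> U) + of_bool (x \<in> U \<and> y \<in> U \<and> w \<in> U)
      + of_bool (x \<in> U \<and> z \<in> U \<and> w \<in> U) + of_bool (y \<in> U \<and> z \<in> U \<and> w \<in> U) :: real"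
    let ?s4 = "\<lambda>x y z w. of_bool (x \<in> U \<and> y \<in> U \<and> z \<in> U \<and> w \<in> U) :: real"
    have term_le: "of_bool (?T (x, y, z, w) \<inter> U \<noteq> {}) * p ^ card (?T (x, y, z, w) - U) \<le>
        p ^ 3 * ?s1 x y z w + p\<^sup>2 * ?s2 x y z w + p * ?s3 x y z w + ?s4 x y z w"
      if "(x, y, z, w) \<in> F" for x y z w
    proof -
      have "distinct [x, y, z, w]" using F that by auto
      then show ?thesis
        using p by (cases "x \<in> U"; cases "y \<in> U"; cases "z \<in> U"; cases "w \<in> U")
          (simp_all add: insert_Diff_if numeral_2_eq_2 numeral_3_eq_3)
    qed
    have "(\<Sum>j | j \<in> F \<and> ?T j \<inter> U \<noteq> {}. p ^ card (?T j - U)) =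
        (\<Sum>j\<in>F. of_bool (?T j \<inter> U \<noteq> {}) * p ^ card (?T j - U))"
      using finF by (intro sum.mono_neutral_cong_left) auto
    also have "\<dots> \<le> (\<Sum>(x, y, z, w)\<in>F. p ^ 3 * ?s1 x y z w + p\<^sup>2 * ?s2 x y z w + p * ?s3 x y z w + ?s4 x y z w)"
      using term_le by (intro sum_mono) (simp only: split_paired_all split)
    also have "\<dots> = p ^ 3 * (C (\<lambda>(x, y, z, w). x \<in> U) + C (\<lambda>(x, y, z, w). y \<in> U)
          + C (\<lambda>(x, y, z, w). z \<in> U) + C (\<lambda>(x, y, z, w). w \<in> U))
        + p\<^sup>2 * (C (\<lambda>(x, y, z, w). x \<in> U \<and> y \<in> U) + C (\<lambda>(x, y, z, w). x \<in> U \<and> z \<in> U)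
          + C (\<lambda>(x, y, z, w). y \<in> U \<and> z \<in> U) + C (\<lambda>(x, y, z, w). x \<in> U \<and> w \<in> U)
          + C (\<lambda>(x, y, z, w). y \<in> U \<and> w \<in> U) + C (\<lambda>(x, y, z, w). z \<in> U \<and> w \<in> U))
        + p * (C (\<lambda>(x, y, z, w). x \<in> U \<and> y \<in> U \<and> z \<in> U) + C (\<lambda>(x, y, z, w). x \<in> U \<and> y \<in> U \<and> w \<in> U)
          + C (\<lambda>(x, y, z, w). x \<in> U \<and> z \<in> U \<and> w \<in> U) + C (\<lambda>(x, y, z, w). y \<in> U \<and> z \<in> U \<and> w \<in> U))
        + C (\<lambda>(x, y, z, w). x \<in> U \<and> y \<in> U \<and> z \<in> U \<and> w \<in> U)"
    proof -
      have C: "C R = (\<Sum>t\<in>F. of_bool (R t))" for R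
        using finF by (simp add: C_def Int_def)
      show ?thesis
        unfolding C by (simp only: case_prod_unfold sum.distrib sum_distrib_left[symmetric])
    qed
    also have "\<dots> \<le> p ^ 3 * (4 * (4 * N\<^sup>2)) + p\<^sup>2 * (6 * (16 * N)) + p * (4 * 64) + 256"
      using single double triple quad p by (intro add_mono mult_left_mono) auto
    finally show ?thesis by (simp add: mult_ac)
  qed
  have card4: "card (?T i) = 4" if "i \<in> F" for i
    using F that by auto
  have "subset_expectation p S (\<lambda>A. of_bool (\<forall>i\<in>F. \<not> ?T i \<subseteq> A))
    \<le> exp (- \<mu> / (4 * (16 * ((real N)\<^sup>2 * p ^ 3) + 96 * (N * p\<^sup>2) + 256 * p + 256)))"
  proof (rule Janson_uniform[OF finS p finF])
    fix i assume i: "i \<in> F"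
    then show "?T i \<subseteq> S" using F by auto
    show "(\<Sum>j | j \<in> F \<and> ?T j \<inter> ?T i \<noteq> {}. p ^ card (?T j - ?T i))
      \<le> 16 * ((real N)\<^sup>2 * p ^ 3) + 96 * (N * p\<^sup>2) + 256 * p + 256"
      using card4[OF i] by (rule sum_le)
  next
    show "0 < 16 * ((real N)\<^sup>2 * p ^ 3) + 96 * (N * p\<^sup>2) + 256 * p + 256"
      using p by (simp add: add_nonneg_pos)
    have "(\<Sum>i\<in>F. p ^ card (?T i)) = (\<Sum>i\<in>F. p ^ 4)"
      by (intro sum.cong refl) (simp only: card4)
    then show "\<mu> \<le> (\<Sum>i\<in>F. p ^ card (?T i))" using \<mu> by simp
  qed
  then show ?thesis by (simp only: case_prod_unfold of_nat_power)
qed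

section \<open>A sparse generating set and a tail bound\<close>

text \<open>Two short intervals at the ends of \<open>\<int>\<^sub>N\<close> together with the multiples of \<open>M\<close>: for
  \<open>H \<le> c < 2 H\<close> and \<open>0 \<le> b < H\<close> with \<open>b \<equiv> x + c\<close> modulo \<open>M\<close>, the number \<open>x + c - b\<close> is a multiple of \<open>M\<close>.\<close>
lemma ex_small_generating_set:
  fixes M N :: nat
  assumes M: "0 < M" and N: "4 * M\<^sup>2 \<le> N"
  shows "\<exists>W\<subseteq>residues_below N. card W * M \<le> 6 * N \<and>
    (\<forall>x\<in>residues_below N - W. \<exists>F. F \<subseteq> {(b, c, d). b \<in> W \<and> c \<in> W \<and> d \<in> W \<and>
        b \<noteq> c \<and> b \<noteq> d \<and> c \<noteq> d \<and> (c + d - b) mod int N \<in> {x}} \<and>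
      (real N)\<^sup>2 / (8 * real M ^ 3) \<le> card F)"
proof -
  define h where "h = N div M"
  define k where "k = h div M"
  define n m H where "n = int N" and "m = int M" and "H = int h"
  \<comment> \<open>The pieces have at most \<open>2 h\<close>, \<open>2 h\<close> and
    \<open>h + 1\<close> elements, with \<open>h\<close> about \<open>N / M\<close>; this accounts
    for the bound \<open>6 * N / M\<close>.\<close>
  define W where "W = {0..<2 * H} \<union> {n - 2 * H..<n} \<union> {z \<in> {0..<n}. m dvd z}"
  let ?Z = "residues_below N"
  have Z: "?Z = {0..<n}" by (simp add: residues_below_def n_def)
  have MN: "4 * (M * M) \<le> N" using N by (simp add: power2_eq_square)
  have M1: "1 * M \<le> M * M" using M by (intro mult_right_mono) auto
  have hM: "h * M \<le> N" and kM: "k * M \<le> h" by (simp_all add: h_def k_def)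
  have Nh: "N < h * M + M" and hk: "h < k * M + M"
    using M mod_less_divisor[of M N] mod_less_divisor[of M h] div_mult_mod_eq[of N M] div_mult_mod_eq[of h M]
    unfolding h_def k_def by linarith+
  have "card (W \<inter> ?Z) * M \<le> 6 * N"
  proof -
    have "{z \<in> {0..<n}. m dvd z} \<subseteq> (\<lambda>j. m * int j) ` {0..<h + 1}"
    proof clarify
      fix z assume z: "z \<in> {0..<n}" "m dvd z"
      then obtain j where j: "z = m * j" by blast
      have "0 \<le> j" using z j M by (simp add: m_def zero_le_mult_iff)
      moreover have "j \<le> int h"
      proof (rule ccontr)
        assume "\<not> ?thesis"
        then have "m * (int h + 1) \<le> m * j" by (intro mult_left_mono) (auto simp: m_def)
        moreover have "n < m * (int h + 1)"
          using Nh unfolding n_def m_def by (metis (no_types, opaque_lifting) add.commute distrib_left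
            mult.commute mult.right_neutral of_nat_1 of_nat_add of_nat_less_iff of_nat_mult)
        ultimately show False using z j by auto
      qed
      ultimately show "z \<in> (\<lambda>j. m * int j) ` {0..<h + 1}"
        using j by (intro image_eqI[of _ _ "nat j"]) auto
    qed
    then have "card {z \<in> {0..<n}. m dvd z} \<le> card ((\<lambda>j. m * int j) ` {0..<h + 1})"
      by (intro card_mono) auto
    also have "\<dots> \<le> h + 1" using card_image_le[of "{0..<h + 1}" "\<lambda>j. m * int j"] by simp
    finally have "card W \<le> 5 * h + 1"
      unfolding W_def
      using card_Un_le[of "{0..<2 * H} \<union> {n - 2 * H..<n}" "{z \<in> {0..<n}. m dvd z}"]
        card_Un_le[of "{0..<2 * H}" "{n - 2 * H..<n}"]
      by (simp add: H_def)
    then have "card W * M \<le> (5 * h + 1) * M" by (rule mult_right_mono) simp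
    also have "\<dots> = 5 * (h * M) + M" by (simp add: algebra_simps)
    also have "\<dots> \<le> 6 * N" using hM M1 MN by linarith
    finally have "card W * M \<le> 6 * N" .
    moreover have "card (W \<inter> ?Z) * M \<le> card W * M"
      by (intro mult_right_mono card_mono) (auto simp: W_def intro: finite_subset[of _ "{0..<n}"])
    ultimately show ?thesis by linarith
  qed
  moreover have "\<exists>F. F \<subseteq> {(b, c, d). b \<in> W \<inter> ?Z \<and> c \<in> W \<inter> ?Z \<and> d \<in> W \<inter> ?Z \<and>
        b \<noteq> c \<and> b \<noteq> d \<and> c \<noteq> d \<and> (c + d - b) mod int N \<in> {x}} \<and>
      (real N)\<^sup>2 / (8 * real M ^ 3) \<le> card F" if x: "x \<in> ?Z - W \<inter> ?Z" for x
  proof -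
    \<comment> \<open>As both end intervals lie in \<open>W\<close>, a point \<open>x\<close>
      outside \<open>W\<close> is far enough from the ends for \<open>x + c - b\<close> to need no
      reduction modulo \<open>N\<close>.\<close>
    have x: "2 * H \<le> x" "x < n - 2 * H" "0 \<le> x" "x < n"
      using x unfolding W_def Z by auto
    define b where "b c t = (x + c) mod m + m * int t" for c :: int and t :: nat
    \<comment> \<open>The roles differ from the statement: here \<open>c\<close> is the element
      subtracted, through \<open>(x + c - b) + b - c = x\<close>.\<close>
    define f where "f = (\<lambda>(c, t). (c, x + c - b c t, b c t))"
    let ?D = "{H..<2 * H} \<times> {0..<k}"
    have m0: "0 < m" using M by (simp add: m_def)
    have b: "0 \<le> b c t" "b c t < H" if "t < k" for c t
    proof -
      have r: "0 \<le> (x + c) mod m" "(x + c) mod m < m" using m0 by auto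
      have "m * (int t + 1) \<le> m * int k" using that m0 by (intro mult_left_mono) auto
      then have "m * int t + m \<le> m * int k" by (simp add: distrib_left)
      moreover have "0 \<le> m * int t" using m0 by simp
      moreover have "m * int k \<le> H"
        using kM unfolding m_def H_def by (metis mult.commute of_nat_le_iff of_nat_mult)
      ultimately show "0 \<le> b c t" "b c t < H"
        unfolding b_def using r by linarith+
    qed
    have dvd: "m dvd x + c - b c t" for c t
    proof -
      have "m dvd (x + c) - (x + c) mod m" by (simp add: minus_mod_eq_mult_div)
      then have "m dvd ((x + c) - (x + c) mod m) - m * int t" by (rule dvd_diff) simp
      then show ?thesis by (simp add: b_def algebra_simps)
    qed
    have "f ` ?D \<subseteq> {(b, c, d). b \<in> W \<inter> ?Z \<and> c \<in> W \<inter> ?Z \<and> d \<in> W \<inter> ?Z \<and>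
        b \<noteq> c \<and> b \<noteq> d \<and> c \<noteq> d \<and> (c + d - b) mod int N \<in> {x}}"
    proof (rule image_subsetI)
      fix t assume "t \<in> ?D"
      then obtain c t' where t: "t = (c, t')" "H \<le> c" "c < 2 * H" "t' < k" by auto
      show "f t \<in> {(b, c, d). b \<in> W \<inter> ?Z \<and> c \<in> W \<inter> ?Z \<and> d \<in> W \<inter> ?Z \<and>
        b \<noteq> c \<and> b \<noteq> d \<and> c \<noteq> d \<and> (c + d - b) mod int N \<in> {x}}"
        using t(2,3) b[OF t(4), of c] dvd[of c t'] x
        unfolding t(1) f_def W_def Z by (auto simp: n_def)
    qed
    moreover have "inj_on f ?D"
    proof (rule inj_onI)
      fix s t assume "f s = f t"
      then show "s = t" using m0 by (cases s; cases t) (auto simp: f_def b_def)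
    qed
    then have "card (f ` ?D) = h * k"
      by (simp add: card_image card_cartesian_product H_def)
    \<comment> \<open>Since \<open>4 * M\<^sup>2 \<le> N\<close>, the two integer divisions still
      leave \<open>h >= N / (2 M)\<close> and \<open>k >= N / (4 M\<^sup>2)\<close>.\<close>
    moreover have "(real N)\<^sup>2 / (8 * real M ^ 3) \<le> real (h * k)"
    proof -
      have "real N < real (h * M + M)" unfolding of_nat_less_iff by (rule Nh)
      moreover have "real h < real (k * M + M)" unfolding of_nat_less_iff by (rule hk)
      moreover have "real (4 * (M * M)) \<le> real N" unfolding of_nat_le_iff by (rule MN)
      moreover have "real (1 * M) \<le> real (M * M)" unfolding of_nat_le_iff by (rule M1)
      ultimately have r: "real N < real h * M + M" "real h < real k * M + M" "4 * (real M * M) \<le> N" "1 * real M \<le> real M * M"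
        by simp_all
      have "real N / 2 \<le> real h * M" using r by linarith
      then have h: "real N / (2 * M) \<le> h" using M by (simp add: field_simps)
      have "real N / 2 \<le> (real k * M + M) * M"
        using mult_right_mono[of "real h" "real k * M + M" "real M"] r \<open>real N / 2 \<le> real h * M\<close> by linarith
      then have "real N / 4 \<le> real k * (real M * M)" using r by (simp add: algebra_simps)
      then have k: "real N / (4 * (real M * M)) \<le> k" using M by (simp add: field_simps)
      have "(real N)\<^sup>2 / (8 * real M ^ 3) = real N / (2 * M) * (real N / (4 * (real M * M)))"
        by (simp add: power2_eq_square power3_eq_cube)
      also have "\<dots> \<le> real h * real k" using h k by (intro mult_mono) auto
      finally show ?thesis by simp
    qed
    ultimately show ?thesis by (intro exI[of _ "f ` ?D"] conjI) simp_all
  qed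
  ultimately show ?thesis
    by (intro exI[of _ "W \<inter> ?Z"] conjI ballI) simp_all
qed

section \<open>An upper tail bound through exponential moments\<close>

lemma subset_expectation_power_card:
  assumes "finite S"
  shows "subset_expectation p S (\<lambda>A. x ^ card (A \<inter> Y)) = (1 + p * (x - 1)) ^ card (S \<inter> Y)"
  using assms
proof (induction S rule: finite_induct)
  case empty
  then show ?case by simp
next
  case (insert a S)
  have *: "subset_expectation p S (\<lambda>A. x ^ card (insert a A \<inter> Y)) =
      (if a \<in> Y then x else 1) * subset_expectation p S (\<lambda>A. x ^ card (A \<inter> Y))"
  proof -
    have "x ^ card (insert a A \<inter> Y) = (if a \<in> Y then x else 1) * x ^ card (A \<inter> Y)" if "A \<subseteq> S" for A
    proof -
      have "finite (A \<inter> Y)" "a \<notin> A \<inter> Y" using that insert.hyps by (auto intro: finite_subset)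
      then show ?thesis by (auto simp: Int_insert_left)
    qed
    then show ?thesis
      by (simp add: subset_expectation_cmult[symmetric] cong: subset_expectation_cong)
  qed
  have "card (insert a S \<inter> Y) = (if a \<in> Y then Suc (card (S \<inter> Y)) else card (S \<inter> Y))"
    using insert.hyps by (auto simp: Int_insert_left)
  then show ?case
    unfolding subset_expectation_insert[OF insert.hyps] * insert.IH by (simp add: algebra_simps)
qed

text \<open>Markov's inequality for \<open>exp (2 * card (A \<inter> Y))\<close>. As
  \<open>exp 2 - 1 <= 8\<close>, its mean is at most \<open>exp t\<close> when \<open>t\<close> is
  at least eight times the expected cardinality.\<close>

lemma prob_card_Int_ge:
  fixes p t :: real
  assumes "finite S" "0 \<le> p" "p \<le> 1" and t: "8 * p * card (S \<inter> Y) \<le> t"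
  shows "subset_expectation p S (\<lambda>A. of_bool (t \<le> card (A \<inter> Y))) \<le> exp (- t)"
proof -
  have e9: "exp 2 \<le> (9 :: real)"
  proof -
    have "exp 2 = exp 1 * (exp 1 :: real)" by (simp add: exp_add[symmetric])
    also have "\<dots> \<le> 3 * 3" using exp_le by (intro mult_mono) auto
    finally show ?thesis by simp
  qed
  have "of_bool (t \<le> card (A \<inter> Y)) \<le> exp (- (2 * t)) * exp 2 ^ card (A \<inter> Y)" for A
  proof -
    have "exp (- (2 * t)) * exp 2 ^ card (A \<inter> Y) = exp (2 * (real (card (A \<inter> Y)) - t))"
      by (simp add: exp_of_nat_mult[symmetric] exp_add[symmetric] algebra_simps)
    then show ?thesis by (auto simp: of_bool_def)
  qed
  then have "subset_expectation p S (\<lambda>A. of_bool (t \<le> card (A \<inter> Y)))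
      \<le> subset_expectation p S (\<lambda>A. exp (- (2 * t)) * exp 2 ^ card (A \<inter> Y))"
    using assms by (intro subset_expectation_mono) auto
  also have "\<dots> = exp (- (2 * t)) * (1 + p * (exp 2 - 1)) ^ card (S \<inter> Y)"
    using assms(1) by (simp only: subset_expectation_cmult subset_expectation_power_card)
  also have "\<dots> \<le> exp (- (2 * t)) * exp (p * 8) ^ card (S \<inter> Y)"
  proof (intro mult_left_mono power_mono)
    have "1 + p * (exp 2 - 1) \<le> 1 + p * 8" using e9 assms by (intro add_left_mono mult_left_mono) auto
    also have "\<dots> \<le> exp (p * 8)" by (rule exp_ge_add_one_self)
    finally show "1 + p * (exp 2 - 1) \<le> exp (p * 8)" .
  qed (use assms in auto)
  also have "\<dots> = exp (8 * p * card (S \<inter> Y) - 2 * t)"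
    by (simp add: exp_of_nat_mult[symmetric] exp_add[symmetric] algebra_simps)
  also have "\<dots> \<le> exp (- t)" using t by simp
  finally show ?thesis .
qed

section \<open>Isolated subsets\<close>

text \<open>Every nonempty set on which a Freiman homomorphism on \<open>A\<close> deviates from a
  given affine map has this property; see
  \<open>freiman_hom_affine_if_isolated_free\<close>.\<close>

definition isolated_subset :: "nat \<Rightarrow> int set \<Rightarrow> int set \<Rightarrow> bool" where
  "isolated_subset N A E \<longleftrightarrow> E \<subseteq> A \<and> E \<noteq> {} \<and>
    (\<forall>b\<in>A - E. \<forall>c\<in>A - E. \<forall>d\<in>A - E. (c + d - b) mod int N \<notin> E)"

text \<open>Choose \<open>a\<close> in \<open>E\<close> and \<open>b\<close>, \<open>c\<close>
  freely, and put \<open>d = a + b - c\<close>. Having \<open>b\<close>, \<open>c\<close> or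
  \<open>d\<close> in \<open>E\<close>, or \<open>c = d\<close>, excludes at most
  \<open>(3 |E| + 1) |E| N\<close> choices, at most half of all. The other coincidences are then
  excluded too: \<open>b = c\<close> forces \<open>d = a\<close>, and \<open>b = d\<close> forces
  \<open>c = a\<close>.\<close>

lemma many_triples_into:
  fixes N :: nat and E :: "int set"
  defines "Z \<equiv> residues_below N"
  assumes E: "E \<subseteq> Z" and small: "6 * card E + 2 \<le> N"
  shows "card E * N\<^sup>2 \<le> 2 * card {(b, c, d). b \<in> Z - E \<and> c \<in> Z - E \<and> d \<in> Z - E \<and>
    b \<noteq> c \<and> b \<noteq> d \<and> c \<noteq> d \<and> (c + d - b) mod int N \<in> E}" (is "_ \<le> 2 * card ?F")
proof -
  let ?n = "int N"
  have N: "0 < N" using small by simp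
  have fin: "finite Z" "finite E" "card Z = N"
    using finite_subset[OF E] unfolding Z_def by auto
  have Zmod: "x mod ?n = x" if "x \<in> Z" for x
    using that by (simp add: Z_def residues_below_def)
  have inZ: "x mod ?n \<in> Z" for x using N by (simp add: Z_def)
  have eqI: "x = y" if "x \<in> Z" "y \<in> Z" "?n dvd x - y" for x y
    using that residues_below_eqI unfolding Z_def by blast
  let ?d = "\<lambda>a b c. (a + b - c) mod ?n"
  let ?G = "E \<times> Z \<times> Z"
  let ?B1 = "E \<times> E \<times> Z" and ?B2 = "E \<times> Z \<times> E"
  let ?B3 = "{(a, b, c) \<in> ?G. ?d a b c \<in> E}"
  let ?B4 = "{(a, b, c) \<in> ?G. ?d a b c = c}"
  have d_eq: "?n dvd b - b'" if "?d a b c = ?d a b' c" for a b b' c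
    using that by (simp add: mod_eq_dvd_iff)
  have c3: "card ?B3 \<le> card E * card E * N"
  proof -
    have "card ?B3 \<le> card (E \<times> Z \<times> E)"
    proof (rule card_inj_on_le[of "\<lambda>(a, b, c). (a, b, ?d a b c)"])
      show "inj_on (\<lambda>(a, b, c). (a, b, ?d a b c)) ?B3"
        by (rule inj_onI) (auto simp: mod_eq_dvd_iff dvd_diff_commute intro!: eqI)
    qed (use fin in auto)
    then show ?thesis using fin by (simp add: card_cartesian_product mult_ac)
  qed
  have c4: "card ?B4 \<le> card E * N"
  proof -
    have "card ?B4 \<le> card (E \<times> Z)"
    proof (rule card_inj_on_le[of "\<lambda>(a, b, c). (a, c)"])
      show "inj_on (\<lambda>(a, b, c). (a, c)) ?B4"
      proof (rule inj_onI, clarsimp)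
        fix a b b' c assume "b \<in> Z" "b' \<in> Z" "?d a b c = c" "?d a b' c = c"
        then show "b = b'" using d_eq[of a b c b'] by (intro eqI) auto
      qed
    qed (use fin in auto)
    then show ?thesis using fin by (simp add: card_cartesian_product)
  qed
  have "card ?G \<le> card ?F + (card ?B1 + (card ?B2 + (card ?B3 + card ?B4)))"
  proof -
    have "card (?G - (?B1 \<union> (?B2 \<union> (?B3 \<union> ?B4)))) \<le> card ?F"
    proof (rule card_inj_on_le[of "\<lambda>(a, b, c). (b, c, ?d a b c)"])
      show "inj_on (\<lambda>(a, b, c). (b, c, ?d a b c)) (?G - (?B1 \<union> (?B2 \<union> (?B3 \<union> ?B4))))"
        by (rule inj_onI) (use E in \<open>auto simp: mod_eq_dvd_iff intro!: eqI\<close>)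
      show "(\<lambda>(a, b, c). (b, c, ?d a b c)) ` (?G - (?B1 \<union> (?B2 \<union> (?B3 \<union> ?B4)))) \<subseteq> ?F"
      proof (rule image_subsetI)
        fix t assume t: "t \<in> ?G - (?B1 \<union> (?B2 \<union> (?B3 \<union> ?B4)))"
        then obtain a b c where abc: "t = (a, b, c)" and a: "a \<in> E" and b: "b \<in> Z" and c: "c \<in> Z"
          by auto
        with t have no: "(a, b, c) \<notin> ?B1 \<union> (?B2 \<union> (?B3 \<union> ?B4))" by simp
        have aZ: "a \<in> Z" using a E by auto
        have 1: "b \<in> Z - E" "c \<in> Z - E" using no a b c by auto
        have 2: "?d a b c \<in> Z - E" "c \<noteq> ?d a b c" using no a b c inZ by auto
        have 3: "b \<noteq> c"
        proof
          assume "b = c"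
          then have "?d a b c = a" using Zmod[OF aZ] by simp
          then show False using no a b c by auto
        qed
        have 4: "b \<noteq> ?d a b c"
        proof
          assume *: "b = ?d a b c"
          have "?n dvd a + b - c - ?d a b c" by simp
          then have "?n dvd a - c" using * by simp
          then have "a = c" using aZ c by (intro eqI)
          then show False using no a b c by auto
        qed
        have "(c + ?d a b c - b) mod ?n = (c + (a + b - c) - b) mod ?n"
          by (metis mod_add_right_eq mod_diff_left_eq)
        then have "(c + ?d a b c - b) mod ?n \<in> E" using Zmod[OF aZ] a by simp
        then show "(\<lambda>(a, b, c). (b, c, ?d a b c)) t \<in> ?F" using 1 2 3 4 unfolding abc by simp
      qed
    qed (use fin in \<open>auto intro: finite_subset[of _ "Z \<times> Z \<times> Z"]\<close>)
    moreover have "card ?G \<le> card (?G - (?B1 \<union> (?B2 \<union> (?B3 \<union> ?B4)))) + card (?B1 \<union> (?B2 \<union> (?B3 \<union> ?B4)))"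
    proof -
      have "finite (?B1 \<union> (?B2 \<union> (?B3 \<union> ?B4)))"
        by (rule finite_subset[of _ ?G]) (use E fin in auto)
      from diff_card_le_card_Diff[OF this, of ?G] show ?thesis by linarith
    qed
    moreover have "card (?B1 \<union> (?B2 \<union> (?B3 \<union> ?B4))) \<le> card ?B1 + (card ?B2 + (card ?B3 + card ?B4))"
      by (meson add_left_mono card_Un_le order_trans)
    ultimately show ?thesis by linarith
  qed
  then have "card E * N\<^sup>2 \<le> card ?F + (card E * N) * (3 * card E + 1)"
    using c3 c4 fin by (simp add: card_cartesian_product power2_eq_square algebra_simps)
  moreover have "(card E * N) * (6 * card E + 2) \<le> (card E * N) * N"
    using small by (rule mult_left_mono) simp
  ultimately show ?thesis
    by (simp add: power2_eq_square algebra_simps)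
qed

text \<open>A single term of the exponential series at \<open>n * t\<close> with
  \<open>t = exp (- 7)\<close>, which is at most 1/1000.\<close>

lemma power_over_fact_le:
  fixes n :: real
  assumes "0 \<le> n"
  shows "n ^ k / fact k \<le> exp (n / 1000 + 7 * k)"
proof -
  define t :: real where "t = exp (- 7)"
  have t: "t \<le> 1 / 1000"
  proof -
    have "(1000::real) \<le> (27/10) ^ 7" by (simp add: power_divide field_simps)
    also have "\<dots> \<le> exp 1 ^ 7"
      using exp_ge_add_one_self[of "1::real"] e_approx_32 by (intro power_mono) (auto simp: abs_if split: if_splits)
    also have "\<dots> = exp 7" by (simp add: exp_of_nat_mult[symmetric])
    finally show ?thesis by (simp add: t_def exp_minus field_simps)
  qed
  have "(n * t) ^ k / fact k \<le> exp (n * t)"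
  proof -
    have "(\<Sum>i\<in>{k}. (n * t) ^ i /\<^sub>R fact i) \<le> (\<Sum>i. (n * t) ^ i /\<^sub>R fact i)"
      using assms by (intro sum_le_suminf summable_exp_generic) (auto simp: t_def)
    then show ?thesis by (simp add: exp_def divide_inverse mult.commute)
  qed
  also have "\<dots> \<le> exp (n / 1000)" using mult_left_mono[OF t assms] by simp
  finally have "n ^ k / fact k \<le> exp (n / 1000) / t ^ k"
    by (simp add: t_def power_mult_distrib field_simps)
  also have "t ^ k = exp (- (7 * real k))"
    by (simp add: t_def exp_of_nat_mult[symmetric])
  also have "exp (n / 1000) / exp (- (7 * real k)) = exp (n / 1000 + 7 * k)"
    by (simp add: exp_diff[symmetric])
  finally show ?thesis .
qed

text \<open>The expected number of isolated sets of size \<open>e\<close> is at most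
  \<open>(N choose e) p\<^sup>e exp (- \<mu> / (4 \<delta>))\<close>. The exponent is of order \<open>e log N\<close> as long as
  \<open>e N p\<^sup>2\<close> is bounded, and of order \<open>N p\<close> beyond that point.\<close>
lemma prob_isolated_subset:
  fixes N :: nat and p :: real
  assumes N: "100 \<le> N" and p: "0 \<le> p" "p \<le> 1" and u: "N * p\<^sup>2 \<le> 1"
    and lam: "2592 * ln N \<le> (real N)\<^sup>2 * p ^ 3" and n: "600 * ln N \<le> N * p"
  shows "subset_expectation p (residues_below N)
      (\<lambda>A. of_bool (\<exists>E. isolated_subset N A E \<and> card E \<le> N * p / 3500)) \<le> 1 / N"
proof -
  let ?Z = "residues_below N"
  define \<E> where "\<E> = {E. E \<subseteq> ?Z \<and> E \<noteq> {} \<and> card E \<le> N * p / 3500}"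
  define F where "F E = {(b, c, d). b \<in> ?Z - E \<and> c \<in> ?Z - E \<and> d \<in> ?Z - E \<and>
    b \<noteq> c \<and> b \<noteq> d \<and> c \<noteq> d \<and> (c + d - b) mod int N \<in> E}" for E
  define B where "B e = exp (- (e * (real N)\<^sup>2 / 2 * p ^ 3) / (4 * (9 * e * (N * p\<^sup>2) + 27 * e * p + 27)))" for e :: real
  have fin\<E>: "finite \<E>" unfolding \<E>_def by (auto intro: finite_subset[of _ "Pow ?Z"])
  have NR: "100 \<le> real N" using N by simp
  have Np: "N * p \<le> N" using p NR by (simp add: mult_left_le)
  have L: "1 \<le> ln (real N)"
  proof -
    have "exp 1 \<le> real N" using exp_le NR by linarith
    then show ?thesis using NR by (subst ln_ge_iff) auto
  qed
  have e_small: "6 * card E + 2 \<le> N" if "E \<in> \<E>" for E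
  proof -
    have "real (card E) \<le> N / 3500" using that Np by (simp add: \<E>_def)
    then show ?thesis using NR by linarith
  qed
  have single: "subset_expectation p ?Z (\<lambda>A. of_bool (isolated_subset N A E)) \<le> p ^ card E * B (card E)"
    if E: "E \<in> \<E>" for E
  proof -
    have EZ: "E \<subseteq> ?Z" using E by (simp add: \<E>_def)
    have finE: "finite E" using EZ by (rule finite_subset) simp
    have "subset_expectation p ?Z (\<lambda>A. of_bool (isolated_subset N A E)) \<le>
      subset_expectation p ?Z (\<lambda>A. of_bool (E \<subseteq> A) * of_bool (\<forall>(b, c, d)\<in>F E. \<not> {b, c, d} \<subseteq> A))"
    proof (intro subset_expectation_mono p)
      fix A
      show "of_bool (isolated_subset N A E)
        \<le> (of_bool (E \<subseteq> A) * of_bool (\<forall>(b, c, d)\<in>F E. \<not> {b, c, d} \<subseteq> A) :: real)"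
        by (auto simp: isolated_subset_def F_def)
    qed
    also have "\<dots> = p ^ card E * subset_expectation p ?Z (\<lambda>A. of_bool (\<forall>(b, c, d)\<in>F E. \<not> {b, c, d} \<subseteq> A \<union> E))"
      using EZ by (intro subset_expectation_superset) auto
    \<comment> \<open>The triples in \<open>F E\<close> avoid \<open>E\<close>, so adding
      \<open>E\<close> to \<open>A\<close> creates none of them.\<close>
    also have "subset_expectation p ?Z (\<lambda>A. of_bool (\<forall>(b, c, d)\<in>F E. \<not> {b, c, d} \<subseteq> A \<union> E))
      = subset_expectation p ?Z (\<lambda>A. of_bool (\<forall>(b, c, d)\<in>F E. \<not> {b, c, d} \<subseteq> A))"
      by (intro subset_expectation_cong arg_cong[where f=of_bool] ball_cong refl) (auto simp: F_def)
    also have "\<dots> \<le> B (card E)"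
      unfolding B_def
    proof (rule Janson_triples[OF p order_refl finE])
      show "F E \<subseteq> {(b, c, d). b \<in> ?Z \<and> c \<in> ?Z \<and> d \<in> ?Z \<and> b \<noteq> c \<and> b \<noteq> d \<and> c \<noteq> d \<and> (c + d - b) mod int N \<in> E}"
        by (auto simp: F_def)
      have "card E * N\<^sup>2 \<le> 2 * card (F E)"
        unfolding F_def by (rule many_triples_into[OF EZ e_small[OF E]])
      then have "real (card E) * (real N)\<^sup>2 \<le> 2 * real (card (F E))"
        by (metis of_nat_le_iff of_nat_mult of_nat_numeral of_nat_power)
      then show "real (card E) * (real N)\<^sup>2 / 2 * p ^ 3 \<le> real (card (F E)) * p ^ 3"
        using p by (intro mult_right_mono) auto
    qed
    finally show ?thesis using p by (simp add: mult_left_mono)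
  qed
  have level: "(N choose e) * (p ^ e * B e) \<le> 1 / (real N)\<^sup>2" if e: "1 \<le> e" "e \<le> N * p / 3500" for e
  proof -
    have e1: "1 \<le> real e" using e by simp
    have ep: "e * p \<le> 1"
    proof -
      have "e * p \<le> N * p / 3500 * p" using e p by (intro mult_right_mono) auto
      then show ?thesis using u by (simp add: power2_eq_square)
    qed
    have bin: "(N choose e) * p ^ e \<le> (N * p) ^ e / fact e"
    proof -
      have "real (N choose e) * fact e \<le> real N ^ e"
        using binomial_fact_pow[of N e] by (metis of_nat_fact of_nat_le_iff of_nat_mult of_nat_power)
      then have "real (N choose e) * fact e * p ^ e \<le> real N ^ e * p ^ e"
        using p by (intro mult_right_mono) auto
      then show ?thesis by (simp add: power_mult_distrib field_simps)
    qed
    have N2: "1 / (real N)\<^sup>2 = exp (- 2 * ln N)"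
      using NR by (simp add: exp_minus ln_realpow[symmetric] field_simps flip: ln_powr)
    have Bpos: "0 < B e" by (simp add: B_def)
    have den0: "0 < 4 * (9 * real e * (N * p\<^sup>2) + 27 * real e * p + 27)"
      using p by (simp add: add_nonneg_pos)
    show ?thesis
    proof (cases "e * (N * p\<^sup>2) \<le> 6")
      case True
      \<comment> \<open>Here \<open>4 * (54 + 27 + 27) = 432\<close>, and
        \<open>2592 / (2 * 432) = 3\<close>. So \<open>B e\<close> is at most \<open>N\<close> to
        the power \<open>- 3 e\<close>, which beats the at most \<open>N ^ e\<close> from the choice
        of the set.\<close>
      have "4 * (9 * real e * (N * p\<^sup>2) + 27 * real e * p + 27) \<le> 432" using True ep by simp
      then have "real e * (real N)\<^sup>2 / 2 * p ^ 3 / 432 \<le> real e * (real N)\<^sup>2 / 2 * p ^ 3 / (4 * (9 * real e * (N * p\<^sup>2) + 27 * real e * p + 27))"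
        using den0 p by (intro divide_left_mono) auto
      moreover have "e * (2592 * ln N) \<le> e * ((real N)\<^sup>2 * p ^ 3)" using lam by (intro mult_left_mono) auto
      ultimately have B: "B e \<le> exp (- (3 * real e * ln N))"
      proof -
        let ?X = "real e * (real N)\<^sup>2 / 2 * p ^ 3"
        let ?Y = "?X / (4 * (9 * real e * (N * p\<^sup>2) + 27 * real e * p + 27))"
        assume 1: "?X / 432 \<le> ?Y" and 2: "e * (2592 * ln N) \<le> e * ((real N)\<^sup>2 * p ^ 3)"
        have "?X / 432 = e * ((real N)\<^sup>2 * p ^ 3) / 864" by simp
        then have "3 * real e * ln N \<le> ?Y" using 1 2 by linarith
        then show ?thesis unfolding B_def by (simp only: exp_le_cancel_iff minus_divide_left[symmetric])
      qed
      have "(N choose e) * p ^ e \<le> (N * p) ^ e / 1"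
      proof -
        have "(N * p) ^ e / fact e \<le> (N * p) ^ e / 1" using p by (intro divide_left_mono) auto
        with bin show ?thesis by linarith
      qed
      also have "\<dots> \<le> real N ^ e" using Np p by (simp add: power_mono)
      also have "\<dots> = exp (e * ln N)" using NR by (simp add: exp_of_nat_mult)
      finally have "(N choose e) * p ^ e * B e \<le> exp (e * ln N) * exp (- (3 * real e * ln N))"
        using B Bpos by (intro mult_mono) auto
      also have "\<dots> = exp (- 2 * (e * ln N))" by (simp add: exp_add[symmetric])
      also have "\<dots> \<le> exp (- 2 * ln N)" using mult_right_mono[OF e1, of "ln N"] L by simp
      finally show ?thesis using N2 by (simp add: mult_ac)
    next
      case False
      then have p0: "0 < p" using p by (cases "p = 0") auto
      \<comment> \<open>As \<open>e * p \<le> 1\<close>, the last two terms total at most 54, which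
        is less than \<open>9 * (e * (N * p\<^sup>2))\<close> in this case.\<close>
      have eu: "9 * real e * (N * p\<^sup>2) + 27 * real e * p + 27 \<le> 18 * (e * (N * p\<^sup>2))"
        using False ep by (simp only: mult.assoc)
      have "N * p / 144 = real e * (real N)\<^sup>2 / 2 * p ^ 3 / (4 * (18 * (e * (N * p\<^sup>2))))"
        using p0 NR e1 by (simp add: field_simps power2_eq_square power3_eq_cube)
      also have "\<dots> \<le> real e * (real N)\<^sup>2 / 2 * p ^ 3 / (4 * (9 * real e * (N * p\<^sup>2) + 27 * real e * p + 27))"
        using den0 eu p0 NR e1 by (intro divide_left_mono mult_left_mono mult_pos_pos) (auto intro: add_nonneg_pos)
      finally have B: "B e \<le> exp (- (N * p / 144))" unfolding B_def by simp
      have "(N choose e) * p ^ e \<le> exp (N * p / 1000 + 7 * e)"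
      proof -
        have "0 \<le> N * p" using p by simp
        from order_trans[OF bin power_over_fact_le[OF this]] show ?thesis .
      qed
      then have "(N choose e) * p ^ e * B e \<le> exp (N * p / 1000 + 7 * e) * exp (- (N * p / 144))"
        using B Bpos by (intro mult_mono) auto
      also have "\<dots> = exp (N * p / 1000 + 7 * e - N * p / 144)" by (simp add: exp_add[symmetric])
      \<comment> \<open>From \<open>e \<le> N * p / 3500\<close> the exponent is at most
        \<open>N p (1/1000 + 1/500 - 1/144)\<close>, which is below \<open>- N p / 300\<close>; the
        hypothesis \<open>n\<close> finishes.\<close>
      also have "\<dots> \<le> exp (- 2 * ln N)"
        unfolding exp_le_cancel_iff using e n L by linarith
      finally show ?thesis using N2 by (simp add: mult_ac)
    qed
  qed
  have "subset_expectation p ?Z (\<lambda>A. of_bool (\<exists>E. isolated_subset N A E \<and> card E \<le> N * p / 3500))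
    \<le> subset_expectation p ?Z (\<lambda>A. \<Sum>E\<in>\<E>. of_bool (isolated_subset N A E))"
  proof (intro subset_expectation_mono p)
    fix A assume A: "A \<subseteq> ?Z"
    show "of_bool (\<exists>E. isolated_subset N A E \<and> card E \<le> N * p / 3500)
      \<le> (\<Sum>E\<in>\<E>. of_bool (isolated_subset N A E) :: real)"
    proof (cases "\<exists>E. isolated_subset N A E \<and> card E \<le> N * p / 3500")
      case True
      then obtain E where E: "isolated_subset N A E" "card E \<le> N * p / 3500" by blast
      then have "E \<in> \<E>" using A by (auto simp: \<E>_def isolated_subset_def)
      then have "of_bool (isolated_subset N A E) \<le> (\<Sum>E\<in>\<E>. of_bool (isolated_subset N A E) :: real)"
        using fin\<E> by (intro member_le_sum) auto
      then show ?thesis using True E by simp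
    next
      case False
      then have "of_bool (\<exists>E. isolated_subset N A E \<and> card E \<le> N * p / 3500) = (0 :: real)"
        by (simp only: of_bool_eq)
      then show ?thesis by (simp only:) (intro sum_nonneg, simp)
    qed
  qed
  also have "\<dots> = (\<Sum>E\<in>\<E>. subset_expectation p ?Z (\<lambda>A. of_bool (isolated_subset N A E)))"
    by (rule subset_expectation_sum)
  also have "\<dots> \<le> (\<Sum>E\<in>\<E>. p ^ card E * B (card E))"
    using single by (intro sum_mono)
  \<comment> \<open>Grouping by cardinality: each of the \<open>N\<close> levels contributes at most
    \<open>1 / N\<^sup>2\<close>.\<close>
  also have "\<dots> = (\<Sum>e\<in>{1..N}. \<Sum>E | E \<in> \<E> \<and> card E = e. p ^ card E * B (card E))"
  proof (rule sum.group[symmetric])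
    show "card ` \<E> \<subseteq> {1..N}"
    proof
      fix e assume "e \<in> card ` \<E>"
      then obtain E where "e = card E" "E \<subseteq> ?Z" "E \<noteq> {}" by (auto simp: \<E>_def)
      then show "e \<in> {1..N}"
        using card_mono[of ?Z E] finite_subset[of E ?Z] by (auto simp: Suc_le_eq card_gt_0_iff)
    qed
  qed (use fin\<E> in auto)
  also have "\<dots> \<le> (\<Sum>e\<in>{1..N}. 1 / (real N)\<^sup>2)"
  proof (intro sum_mono)
    fix e assume e: "e \<in> {1..N}"
    show "(\<Sum>E | E \<in> \<E> \<and> card E = e. p ^ card E * B (card E)) \<le> 1 / (real N)\<^sup>2"
    proof (cases "e \<le> N * p / 3500")
      case True
      have "card {E. E \<in> \<E> \<and> card E = e} \<le> card {E. E \<subseteq> ?Z \<and> card E = e}"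
        by (intro card_mono) (auto simp: \<E>_def)
      also have "\<dots> = N choose e" by (simp add: n_subsets)
      finally have "real (card {E. E \<in> \<E> \<and> card E = e}) * (p ^ e * B e) \<le> (N choose e) * (p ^ e * B e)"
        using p by (intro mult_right_mono) (auto simp: B_def)
      also have "\<dots> \<le> 1 / (real N)\<^sup>2" using level[of e] e True by simp
      finally show ?thesis by simp
    next
      case False
      then have empty: "{E. E \<in> \<E> \<and> card E = e} = {}" by (auto simp: \<E>_def)
      show ?thesis unfolding empty by simp
    qed
  qed
  also have "\<dots> = 1 / N" using NR by (simp add: power2_eq_square)
  finally show ?thesis .
qed

section \<open>From pseudorandomness to affinity\<close>

definition represented :: "nat \<Rightarrow> int set \<Rightarrow> int \<Rightarrow> bool" where
  "represented N B x \<longleftrightarrow> (\<exists>b\<in>B. \<exists>c\<in>B. \<exists>d\<in>B. (c + d - b) mod int N = x)"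

text \<open>The choice depends on \<open>N\<close>, \<open>B\<close> and \<open>x\<close> but on no
  map, so a map on \<open>B\<close> and its rounded version are extended along the same
  triples.\<close>

definition chosen_representation :: "nat \<Rightarrow> int set \<Rightarrow> int \<Rightarrow> int \<times> int \<times> int" where
  "chosen_representation N B x = (SOME (b, c, d). b \<in> B \<and> c \<in> B \<and> d \<in> B \<and> (c + d - b) mod int N = x)"

text \<open>The value at \<open>x\<close> that a Freiman homomorphism extending \<open>g\<close> from \<open>B\<close> to \<open>B \<union> {x}\<close> must have;
  an arbitrary integer if \<open>x\<close> is not represented.\<close>
definition forced_value :: "nat \<Rightarrow> int set \<Rightarrow> (int \<Rightarrow> int) \<Rightarrow> int \<Rightarrow> int" where
  "forced_value N B g x = (case chosen_representation N B x of (b, c, d) \<Rightarrow> g c + g d - g b)"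

text \<open>With \<open>G\<close> a forced value of a rounded map, this set is determined by
  \<open>A \<inter> W\<close> and one of finitely many maps, hence independent of
  \<open>A - W\<close>. Entries are distinct so that \<open>Janson_quadruples\<close>
  applies.\<close>

definition far_quadruples :: "nat \<Rightarrow> int set \<Rightarrow> (int \<Rightarrow> int) \<Rightarrow> (int \<times> int \<times> int \<times> int) set" where
  "far_quadruples N V G = {(x, y, z, w). x \<in> V \<and> y \<in> V \<and> z \<in> V \<and> w \<in> V \<and> distinct [x, y, z, w] \<and>
    int N dvd x + y - z - w \<and> far_mod_150 (G x + G y - G z - G w)}"

definition far_points :: "nat \<Rightarrow> int set \<Rightarrow> (int \<Rightarrow> int) \<Rightarrow> int \<Rightarrow> int \<Rightarrow> int set" where
  "far_points N V G r s = {x \<in> V. far_mod_150 (G x - rounded N (r * x + s))}"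

lemma chosen_representationE:
  assumes "represented N B x"
  obtains b c d where "chosen_representation N B x = (b, c, d)" "b \<in> B" "c \<in> B" "d \<in> B"
    "(c + d - b) mod int N = x"
proof -
  have "\<exists>t. case t of (b, c, d) \<Rightarrow> b \<in> B \<and> c \<in> B \<and> d \<in> B \<and> (c + d - b) mod int N = x"
    using assms by (auto simp: represented_def)
  from someI_ex[OF this] show thesis
    by (intro that[of "fst (chosen_representation N B x)" "fst (snd (chosen_representation N B x))" "snd (snd (chosen_representation N B x))"])
      (auto simp: chosen_representation_def case_prod_unfold)
qed

section \<open>Deterministic consequences of the Freiman condition\<close>

lemma freiman_hom_dvd:
  assumes "freiman_hom N A \<phi>" "a \<in> A" "b \<in> A" "c \<in> A" "d \<in> A" "int N dvd a + b - c - d"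
  shows "int N dvd \<phi> a + \<phi> b - \<phi> c - \<phi> d"
proof -
  have "(a + b) mod int N = (c + d) mod int N"
    using assms(6) unfolding mod_eq_dvd_iff diff_diff_eq .
  then have "a \<oplus>\<^bsub>Z_mod N\<^esub> b = c \<oplus>\<^bsub>Z_mod N\<^esub> d"
    by (simp add: residue_ring_def)
  moreover have "\<forall>a\<in>A. \<forall>b\<in>A. \<forall>c\<in>A. \<forall>d\<in>A.
      a \<oplus>\<^bsub>Z_mod N\<^esub> b = c \<oplus>\<^bsub>Z_mod N\<^esub> d \<longrightarrow>
      \<phi> a \<oplus>\<^bsub>Z_mod N\<^esub> \<phi> b = \<phi> c \<oplus>\<^bsub>Z_mod N\<^esub> \<phi> d"
    using assms(1) unfolding freiman_hom_def by (elim conjE)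
  ultimately have "\<phi> a \<oplus>\<^bsub>Z_mod N\<^esub> \<phi> b = \<phi> c \<oplus>\<^bsub>Z_mod N\<^esub> \<phi> d"
    using assms(2-5) by blast
  then have "(\<phi> a + \<phi> b) mod int N = (\<phi> c + \<phi> d) mod int N"
    by (simp add: residue_ring_def)
  then show ?thesis unfolding mod_eq_dvd_iff diff_diff_eq .
qed

lemma approximates_forced_value:
  assumes N: "0 < N" and x: "represented N B x"
    and g: "\<And>a. a \<in> B \<Longrightarrow> g a = rounded N (m * \<phi> a)"
  shows "approximates N 3 (forced_value N B g x) (m * forced_value N B \<phi> x)"
proof -
  obtain b c d where bcd: "chosen_representation N B x = (b, c, d)" "b \<in> B" "c \<in> B" "d \<in> B"
    using x by (rule chosen_representationE)
  have "approximates N (1 + 1 + 1) (rounded N (m * \<phi> c) + rounded N (m * \<phi> d) - rounded N (m * \<phi> b))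
      (m * \<phi> c + m * \<phi> d - m * \<phi> b)"
    by (intro approximates_add approximates_diff approximates_rounded N)
  then show ?thesis using bcd g by (simp add: forced_value_def algebra_simps)
qed

text \<open>Modulo \<open>N\<close> the difference of \<open>\<phi>\<close> and an affine map still
  respects additive quadruples. If it vanishes at \<open>b\<close>, \<open>c\<close>,
  \<open>d\<close>, it vanishes at \<open>c + d - b\<close> whenever that lies in \<open>A\<close>,
  so a nonempty deviation set would be isolated.\<close>

lemma freiman_hom_affine_if_isolated_free:
  fixes N :: nat and A :: "int set"
  assumes N: "0 < N" and hom: "freiman_hom N A \<phi>"
    and rs: "r \<in> residues_below N" "s \<in> residues_below N"
    and iso: "\<not> isolated_subset N A {a \<in> A. \<not> int N dvd \<phi> a - (r * a + s)}"
  shows "affine_on N A \<phi>"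
proof -
  let ?n = "int N"
  let ?E = "{a \<in> A. \<not> ?n dvd \<phi> a - (r * a + s)}"
  have AZ: "A \<subseteq> {0..<?n}" and \<phi>Z: "\<phi> a \<in> {0..<?n}" if "a \<in> A" for a
    using hom that unfolding freiman_hom_def residue_ring_def by auto
  have "?E = {}"
  proof (rule ccontr)
    assume "?E \<noteq> {}"
    moreover have "(c + d - b) mod ?n \<notin> ?E" if "b \<in> A - ?E" "c \<in> A - ?E" "d \<in> A - ?E" for b c d
    proof
      define a where "a = (c + d - b) mod ?n"
      assume "(c + d - b) mod ?n \<in> ?E"
      then have a: "a \<in> A" "\<not> ?n dvd \<phi> a - (r * a + s)" by (auto simp: a_def)
      have ab: "?n dvd a + b - c - d"
        using dvd_diff_mod[of N "c + d - b"] unfolding a_def[symmetric]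
        by (simp add: dvd_diff_commute algebra_simps)
      have 1: "?n dvd \<phi> a + \<phi> b - \<phi> c - \<phi> d"
        using freiman_hom_dvd[OF hom _ _ _ _ ab] a that by auto
      have 2: "?n dvd r * (a + b - c - d)" using ab by simp
      have 3: "?n dvd \<phi> b - (r * b + s)" "?n dvd \<phi> c - (r * c + s)" "?n dvd \<phi> d - (r * d + s)"
        using that by auto
      have "?n dvd (\<phi> a + \<phi> b - \<phi> c - \<phi> d) - r * (a + b - c - d)
          - (\<phi> b - (r * b + s)) + (\<phi> c - (r * c + s)) + (\<phi> d - (r * d + s))"
        by (rule dvd_add[OF dvd_add[OF dvd_diff[OF dvd_diff[OF 1 2] 3(1)] 3(2)] 3(3)])
      then have "?n dvd \<phi> a - (r * a + s)" by (simp add: algebra_simps)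
      with a show False by simp
    qed
    ultimately have "isolated_subset N A ?E"
      unfolding isolated_subset_def by blast
    with iso show False by simp
  qed
  then have "\<phi> a = (r * a mod ?n + s) mod ?n" if "a \<in> A" for a
  proof -
    have "\<phi> a mod ?n = (r * a + s) mod ?n"
      using \<open>?E = {}\<close> that by (auto simp: mod_eq_dvd_iff)
    then show ?thesis using \<phi>Z[OF that] by (simp add: mod_simps)
  qed
  then show ?thesis
    using rs unfolding affine_on_def residue_ring_def residues_below_def
    by (intro bexI[of _ r] bexI[of _ s]) auto
qed

text \<open>Each of the four entries lying in \<open>W\<close> costs at most
  \<open>card W * N\<^sup>2\<close> triples, and each of the coincidences \<open>x = y\<close> and
  \<open>z = w\<close> costs \<open>N\<^sup>2\<close>. The remaining coincidences make the relation
  trivial, so they are never bad.\<close>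

lemma card_bad_triples_le:
  fixes N :: nat and \<Phi> :: "int \<Rightarrow> int"
  defines "Z \<equiv> residues_below N"
  assumes N: "0 < N" and W: "W \<subseteq> Z"
  shows "card {(x, y, z). x \<in> Z \<and> y \<in> Z \<and> z \<in> Z \<and>
      \<not> int N dvd \<Phi> x + \<Phi> y - \<Phi> z - \<Phi> ((x + y - z) mod int N)}
    \<le> card {(x, y, z, w). x \<in> Z - W \<and> y \<in> Z - W \<and> z \<in> Z - W \<and> w \<in> Z - W \<and> distinct [x, y, z, w] \<and>
        int N dvd x + y - z - w \<and> \<not> int N dvd \<Phi> x + \<Phi> y - \<Phi> z - \<Phi> w}
      + (4 * card W + 2) * N\<^sup>2" (is "card ?Bad \<le> card ?Q + _")
proof -
  let ?n = "int N"
  let ?w = "\<lambda>x y z. (x + y - z) mod ?n"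
  have fin: "finite Z" "card Z = N" "finite W" using finite_subset[OF W] by (auto simp: Z_def)
  have inZ: "x mod ?n \<in> Z" for x using N by (simp add: Z_def)
  have Zmod: "x mod ?n = x" if "x \<in> Z" for x
    using that by (simp add: Z_def residues_below_def)
  have eqI: "x = y" if "x \<in> Z" "y \<in> Z" "?n dvd x - y" for x y
    using that residues_below_eqI unfolding Z_def by blast
  let ?B0 = "{(x, y, z) \<in> ?Bad. (x, y, z, ?w x y z) \<in> ?Q}"
  let ?B1 = "W \<times> Z \<times> Z" and ?B2 = "Z \<times> W \<times> Z" and ?B3 = "Z \<times> Z \<times> W"
  let ?B4 = "{(x, y, z) \<in> Z \<times> Z \<times> Z. ?w x y z \<in> W}"
  let ?B5 = "{(x, y, z) \<in> Z \<times> Z \<times> Z. x = y}"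
  let ?B6 = "{(x, y, z) \<in> Z \<times> Z \<times> Z. ?w x y z = z}"
  have finZ3: "finite X" if "X \<subseteq> Z \<times> Z \<times> Z" for X
    by (rule finite_subset[OF that]) (use fin in auto)
  have "?Bad \<subseteq> ?B0 \<union> (?B1 \<union> (?B2 \<union> (?B3 \<union> (?B4 \<union> (?B5 \<union> ?B6)))))"
  proof (rule subsetI)
    fix t assume t: "t \<in> ?Bad"
    then obtain x y z where xyz: "t = (x, y, z)" "x \<in> Z" "y \<in> Z" "z \<in> Z"
      and bad: "\<not> ?n dvd \<Phi> x + \<Phi> y - \<Phi> z - \<Phi> (?w x y z)" by auto
    have ne: "x \<noteq> z" "y \<noteq> z"
      using bad Zmod xyz by auto
    have ne': "x \<noteq> ?w x y z" "y \<noteq> ?w x y z"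
    proof -
      have "?n dvd x + y - z - ?w x y z" by simp
      then have "?w x y z = x \<Longrightarrow> y = z" "?w x y z = y \<Longrightarrow> x = z"
        using xyz by (auto intro!: eqI)
      then show "x \<noteq> ?w x y z" "y \<noteq> ?w x y z" using ne by auto
    qed
    show "t \<in> ?B0 \<union> (?B1 \<union> (?B2 \<union> (?B3 \<union> (?B4 \<union> (?B5 \<union> ?B6)))))"
    proof (rule ccontr)
      assume no: "t \<notin> ?B0 \<union> (?B1 \<union> (?B2 \<union> (?B3 \<union> (?B4 \<union> (?B5 \<union> ?B6)))))"
      have "x \<notin> W" "y \<notin> W" "z \<notin> W" "?w x y z \<notin> W" "x \<noteq> y" "?w x y z \<noteq> z"
        using no xyz by auto
      then have "(x, y, z, ?w x y z) \<in> ?Q"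
        using xyz bad ne ne' inZ by auto
      then have "t \<in> ?B0" using t xyz by auto
      then show False using no by blast
    qed
  qed
  then have "card ?Bad \<le> card (?B0 \<union> (?B1 \<union> (?B2 \<union> (?B3 \<union> (?B4 \<union> (?B5 \<union> ?B6))))))"
    by (rule card_mono[rotated]) (use W in \<open>auto intro!: finZ3\<close>)
  also have "\<dots> \<le> card ?B0 + (card ?B1 + (card ?B2 + (card ?B3 + (card ?B4 + (card ?B5 + card ?B6)))))"
    using card_Un_le[of ?B0 "?B1 \<union> (?B2 \<union> (?B3 \<union> (?B4 \<union> (?B5 \<union> ?B6))))"]
      card_Un_le[of ?B1 "?B2 \<union> (?B3 \<union> (?B4 \<union> (?B5 \<union> ?B6)))"]
      card_Un_le[of ?B2 "?B3 \<union> (?B4 \<union> (?B5 \<union> ?B6))"] card_Un_le[of ?B3 "?B4 \<union> (?B5 \<union> ?B6)"]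
      card_Un_le[of ?B4 "?B5 \<union> ?B6"] card_Un_le[of ?B5 ?B6] by linarith
  also have "\<dots> \<le> card ?Q + (card W * N\<^sup>2 + (card W * N\<^sup>2 + (card W * N\<^sup>2 + (card W * N\<^sup>2 + (N\<^sup>2 + N\<^sup>2)))))"
  proof (intro add_mono)
    show "card ?B0 \<le> card ?Q"
    proof (rule card_inj_on_le[of "\<lambda>(x, y, z). (x, y, z, ?w x y z)"])
      show "finite ?Q"
        by (rule finite_subset[of _ "Z \<times> Z \<times> Z \<times> Z"]) (use fin in auto)
    qed (auto simp: inj_on_def)
    show "card ?B1 \<le> card W * N\<^sup>2" "card ?B2 \<le> card W * N\<^sup>2" "card ?B3 \<le> card W * N\<^sup>2"
      using fin by (simp_all add: card_cartesian_product power2_eq_square)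
    have "card ?B4 \<le> card (Z \<times> Z \<times> W)"
    proof (rule card_inj_on_le[of "\<lambda>(x, y, z). (x, y, ?w x y z)"])
      show "inj_on (\<lambda>(x, y, z). (x, y, ?w x y z)) ?B4"
        by (rule inj_onI) (auto simp: mod_eq_dvd_iff dvd_diff_commute intro!: eqI)
    qed (use fin in auto)
    then show "card ?B4 \<le> card W * N\<^sup>2"
      using fin by (simp add: card_cartesian_product power2_eq_square mult_ac)
    have "card ?B5 \<le> card (Z \<times> Z)"
      by (rule card_inj_on_le[of "\<lambda>(x, y, z). (x, z)"]) (use fin in \<open>auto simp: inj_on_def\<close>)
    then show "card ?B5 \<le> N\<^sup>2" using fin by (simp add: card_cartesian_product power2_eq_square)
    have "card ?B6 \<le> card (Z \<times> Z)"
    proof (rule card_inj_on_le[of "\<lambda>(x, y, z). (x, z)"])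
      show "inj_on (\<lambda>(x, y, z). (x, z)) ?B6"
      proof (rule inj_onI, clarsimp)
        fix x y y' z assume yy: "y \<in> Z" "y' \<in> Z" and "?w x y z = z" "?w x y' z = z"
        then have "?w x y z = ?w x y' z" by simp
        then have "?n dvd y - y'" by (simp add: mod_eq_dvd_iff)
        with yy show "y = y'" by (intro eqI)
      qed
    qed (use fin in auto)
    then show "card ?B6 \<le> N\<^sup>2" using fin by (simp add: card_cartesian_product power2_eq_square)
  qed
  finally show ?thesis by (simp add: algebra_simps)
qed

text \<open>The deterministic core: \<open>rep\<close>, \<open>quad\<close>, \<open>pts\<close>,
  \<open>cB\<close> and \<open>iso\<close> are the pseudorandom properties of \<open>A\<close> that
  are later shown to hold with high probability.\<close>

lemma freiman_homs_affine:
  fixes N :: nat and A W :: "int set" and c \<rho> n :: real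
  defines "Z \<equiv> residues_below N"
  defines "V \<equiv> Z - W" and "B \<equiv> A \<inter> W"
  assumes N: "0 < N" and A: "A \<subseteq> Z" and W: "W \<subseteq> Z"
    and cW: "card W \<le> \<rho> * N" and N\<rho>: "2 \<le> \<rho> * N"
    and c: "5 * \<rho> \<le> c" "12 * c < 1" "64 * c + 8 * \<rho> \<le> 1 / 3500" and n: "0 \<le> n"
    and rep: "\<And>x. x \<in> V \<Longrightarrow> represented N B x"
    and quad: "\<And>g. g \<in> PiE B (\<lambda>_. {0..<150}) \<Longrightarrow> c / 2 * real N ^ 3 \<le> card (far_quadruples N V (forced_value N B g)) \<Longrightarrow>
      \<exists>(x, y, z, w)\<in>far_quadruples N V (forced_value N B g). {x, y, z, w} \<subseteq> A - W"
    and pts: "\<And>g r s. g \<in> PiE B (\<lambda>_. {0..<150}) \<Longrightarrow> r \<in> Z \<Longrightarrow> s \<in> Z \<Longrightarrow>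
      card (far_points N V (forced_value N B g) r s) \<le> 4 * c * N \<Longrightarrow>
      card ((A - W) \<inter> far_points N V (forced_value N B g) r s) \<le> 32 * c * n"
    and cB: "card B \<le> 8 * \<rho> * n"
    and iso: "\<And>E. isolated_subset N A E \<Longrightarrow> \<not> card E \<le> n / 3500"
    and hom: "freiman_hom N A \<phi>"
  shows "affine_on N A \<phi>"
proof -
  let ?n = "int N"
  define \<Phi> where "\<Phi> = forced_value N B \<phi>"
  have fin: "finite Z" "finite A" "finite V" "finite B" "card Z = N"
    using finite_subset[OF A] by (auto simp: Z_def V_def B_def)
  have VZ: "V \<subseteq> Z" by (auto simp: V_def)
  have DV: "A - W \<subseteq> V" using A by (auto simp: V_def)
  have \<phi>\<Phi>: "?n dvd \<phi> x - \<Phi> x" if "x \<in> A - W" for x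
  proof -
    have "represented N B x" using that DV by (intro rep) blast
    then obtain b c d where bcd: "chosen_representation N B x = (b, c, d)" "b \<in> B" "c \<in> B" "d \<in> B" "(c + d - b) mod ?n = x"
      by (rule chosen_representationE)
    have "?n dvd c + d - b - x" using dvd_diff_mod[of N "c + d - b"] bcd(5) by simp
    then have "?n dvd x + b - c - d" by (simp add: dvd_diff_commute algebra_simps)
    then have "?n dvd \<phi> x + \<phi> b - \<phi> c - \<phi> d"
      using freiman_hom_dvd[OF hom] bcd that by (auto simp: B_def)
    then show ?thesis unfolding \<Phi>_def forced_value_def using bcd(1) by (simp add: algebra_simps)
  qed
  \<comment> \<open>The rounded multiples of \<open>\<phi>\<close> on \<open>B\<close>. They belong
    to the finite family over which \<open>quad\<close> and \<open>pts\<close> range, whatever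
    \<open>\<phi>\<close> is.\<close>
  define g where "g m = restrict (\<lambda>a. rounded N (m * \<phi> a)) B" for m
  have g: "g m \<in> PiE B (\<lambda>_. {0..<150})" for m
    unfolding g_def using rounded_range by (intro restrict_PiE_iff[THEN iffD2]) blast
  have approx: "approximates N 3 (forced_value N B (g m) x) (m * \<Phi> x)" if "x \<in> V" for m x
    unfolding \<Phi>_def using rep[OF that] by (intro approximates_forced_value N) (auto simp: g_def)
  define Q where "Q = {(x, y, z, w). x \<in> V \<and> y \<in> V \<and> z \<in> V \<and> w \<in> V \<and> distinct [x, y, z, w] \<and>
        ?n dvd x + y - z - w \<and> \<not> ?n dvd \<Phi> x + \<Phi> y - \<Phi> z - \<Phi> w}"
  have finQ: "finite Q" unfolding Q_def
    by (rule finite_subset[of _ "V \<times> V \<times> V \<times> V"]) (use fin in auto)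
  have approx4: "approximates N 12 (forced_value N B (g m) x + forced_value N B (g m) y
      - forced_value N B (g m) z - forced_value N B (g m) w) (m * (\<Phi> x + \<Phi> y - \<Phi> z - \<Phi> w))"
    if "x \<in> V" "y \<in> V" "z \<in> V" "w \<in> V" for m x y z w
  proof -
    have "approximates N (3 + 3 + 3 + 3) (forced_value N B (g m) x + forced_value N B (g m) y
      - forced_value N B (g m) z - forced_value N B (g m) w) (m * \<Phi> x + m * \<Phi> y - m * \<Phi> z - m * \<Phi> w)"
      using that by (intro approximates_add approximates_diff approx)
    then show ?thesis by (simp add: algebra_simps)
  qed
  \<comment> \<open>Otherwise some \<open>m\<close> makes half of the violated quadruples far, and
    \<open>quad\<close> puts a far one inside \<open>A - W\<close>. There \<open>\<Phi>\<close>
    agrees with the homomorphism \<open>\<phi>\<close>, so the quadruple is not violated and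
    soundness of the test is contradicted.\<close>
  have cQ: "card Q \<le> c * real N ^ 3"
  proof (rule ccontr)
    assume big: "\<not> ?thesis"
    have "\<exists>m\<in>residues_below N. card Q \<le> 2 * card {q \<in> Q. far_from_zero N (m * (case q of (x, y, z, w) \<Rightarrow> \<Phi> x + \<Phi> y - \<Phi> z - \<Phi> w))}"
      by (rule ex_common_multiplier[OF N finQ]) (auto simp: Q_def)
    then obtain m where m: "card Q \<le> 2 * card {q \<in> Q. far_from_zero N (m * (case q of (x, y, z, w) \<Rightarrow> \<Phi> x + \<Phi> y - \<Phi> z - \<Phi> w))}" by blast
    let ?FQ = "far_quadruples N V (forced_value N B (g m))"
    have "finite ?FQ"
      by (rule finite_subset[of _ "V \<times> V \<times> V \<times> V"]) (use fin in \<open>auto simp: far_quadruples_def\<close>)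
    moreover have "{q \<in> Q. far_from_zero N (m * (case q of (x, y, z, w) \<Rightarrow> \<Phi> x + \<Phi> y - \<Phi> z - \<Phi> w))} \<subseteq> ?FQ"
      unfolding far_quadruples_def Q_def using far_mod_150I[OF N approx4] by auto
    ultimately have "card Q \<le> 2 * card ?FQ"
      using m card_mono by (meson mult_le_mono2 order_trans)
    then have "c / 2 * real N ^ 3 \<le> card ?FQ" using big by linarith
    then obtain x y z w where q: "(x, y, z, w) \<in> ?FQ" "{x, y, z, w} \<subseteq> A - W"
      using quad[OF g, of m] by blast
    have V: "x \<in> V" "y \<in> V" "z \<in> V" "w \<in> V" using q(2) DV by auto
    have "?n dvd \<phi> x + \<phi> y - \<phi> z - \<phi> w"
      using q freiman_hom_dvd[OF hom, of x y z w] by (auto simp: far_quadruples_def)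
    moreover have "?n dvd \<phi> x - \<Phi> x" "?n dvd \<phi> y - \<Phi> y" "?n dvd \<phi> z - \<Phi> z" "?n dvd \<phi> w - \<Phi> w"
      using \<phi>\<Phi> q(2) by simp_all
    ultimately have "?n dvd (\<phi> x + \<phi> y - \<phi> z - \<phi> w) - (\<phi> x - \<Phi> x) - (\<phi> y - \<Phi> y) + (\<phi> z - \<Phi> z) + (\<phi> w - \<Phi> w)"
      using dvd_add[OF dvd_add[OF dvd_diff[OF dvd_diff]]] by blast
    then have "?n dvd \<Phi> x + \<Phi> y - \<Phi> z - \<Phi> w" by (simp add: algebra_simps)
    then have "?n dvd m * (\<Phi> x + \<Phi> y - \<Phi> z - \<Phi> w)" by (rule dvd_mult)
    then have "\<not> far_mod_150 (forced_value N B (g m) x + forced_value N B (g m) y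
      - forced_value N B (g m) z - forced_value N B (g m) w)"
      by (rule not_far_mod_150[OF N approx4[OF V] order_refl])
    then show False using q(1) by (simp add: far_quadruples_def)
  qed
  have "\<exists>r\<in>Z. \<exists>s\<in>Z. card {x \<in> Z. \<not> ?n dvd \<Phi> x - (r * x + s)} \<le> 2 * (2 * c) * N"
    unfolding Z_def
  proof (rule mostly_additive_imp_mostly_affine[OF N])
    show "6 * (2 * c) < 1" using c by simp
    have "card {(x, y, z). x \<in> Z \<and> y \<in> Z \<and> z \<in> Z \<and> \<not> ?n dvd \<Phi> x + \<Phi> y - \<Phi> z - \<Phi> ((x + y - z) mod ?n)}
      \<le> card Q + (4 * card W + 2) * N\<^sup>2"
      unfolding Q_def V_def Z_def by (rule card_bad_triples_le[OF N W[unfolded Z_def]])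
    then have "real (card {(x, y, z). x \<in> Z \<and> y \<in> Z \<and> z \<in> Z \<and> \<not> ?n dvd \<Phi> x + \<Phi> y - \<Phi> z - \<Phi> ((x + y - z) mod ?n)})
      \<le> real (card Q + (4 * card W + 2) * N\<^sup>2)"
      by (rule of_nat_mono)
    also have "\<dots> = card Q + (4 * real (card W) + 2) * (real N)\<^sup>2" by (simp add: algebra_simps)
    \<comment> \<open>The coefficient 5 instead of 4 absorbs the summand 2, by
      \<open>2 \<le> \<rho> * N\<close>.\<close>
    also have "\<dots> \<le> c * real N ^ 3 + (5 * (\<rho> * N)) * (real N)\<^sup>2"
      using cQ cW N\<rho> by (intro add_mono mult_right_mono) auto
    also have "\<dots> = c * real N ^ 3 + 5 * \<rho> * real N ^ 3"
      by (simp add: power2_eq_square power3_eq_cube)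
    also have "\<dots> \<le> c * real N ^ 3 + c * real N ^ 3"
      using c by (intro add_left_mono mult_right_mono) auto
    also have "\<dots> = 2 * c * real N ^ 3" by simp
    finally show "real (card {(x, y, z). x \<in> residues_below N \<and> y \<in> residues_below N \<and> z \<in> residues_below N \<and>
        \<not> ?n dvd \<Phi> x + \<Phi> y - \<Phi> z - \<Phi> ((x + y - z) mod ?n)}) \<le> 2 * c * real N ^ 3"
      unfolding Z_def .
  qed
  then obtain r s where rs: "r \<in> Z" "s \<in> Z"
    and few: "card {x \<in> Z. \<not> ?n dvd \<Phi> x - (r * x + s)} \<le> 4 * c * N" by auto
  define E where "E = {a \<in> A. \<not> ?n dvd \<phi> a - (r * a + s)}"
  define D where "D = E - W"
  have D: "card D \<le> 64 * c * n"
  proof -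
    have bad: "\<not> ?n dvd \<Phi> a - (r * a + s)" if a: "a \<in> D" for a
    proof
      assume "?n dvd \<Phi> a - (r * a + s)"
      moreover have "?n dvd \<phi> a - \<Phi> a" using \<phi>\<Phi> a by (auto simp: D_def E_def)
      ultimately have "?n dvd (\<Phi> a - (r * a + s)) + (\<phi> a - \<Phi> a)" by (rule dvd_add)
      moreover have "(\<Phi> a - (r * a + s)) + (\<phi> a - \<Phi> a) = \<phi> a - (r * a + s)" by simp
      ultimately show False using a by (simp add: D_def E_def)
    qed
    have "finite D" using fin by (simp add: D_def E_def)
    then obtain m where m: "card D \<le> 2 * card {a \<in> D. far_from_zero N (m * (\<Phi> a - (r * a + s)))}"
      using ex_common_multiplier[OF N, of D "\<lambda>a. \<Phi> a - (r * a + s)"] bad by blast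
    \<comment> \<open>Multiplying the affine map by \<open>m\<close> gives an affine map again,
      covered by the quantification over \<open>r\<close>, \<open>s\<close> in \<open>pts\<close>.
      Its rounding raises the error from 3 to 4.\<close>
    define r' s' where "r' = (m * r) mod ?n" and "s' = (m * s) mod ?n"
    have rs': "r' \<in> Z" "s' \<in> Z" using N by (auto simp: r'_def s'_def Z_def)
    have cong: "(m * \<Phi> x - (r' * x + s')) mod ?n = (m * (\<Phi> x - (r * x + s))) mod ?n" for x
    proof -
      have "[m * \<Phi> x - (r' * x + s') = m * \<Phi> x - (m * r * x + m * s)] (mod ?n)"
        unfolding r'_def s'_def by (intro cong_diff cong_add cong_mult cong_refl) (simp_all add: cong_def)
      then show ?thesis by (simp add: cong_def algebra_simps)
    qed
    let ?FP = "far_points N V (forced_value N B (g m)) r' s'"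
    have approx': "approximates N 4 (forced_value N B (g m) x - rounded N (r' * x + s')) (m * \<Phi> x - (r' * x + s'))"
      if "x \<in> V" for x
      using approximates_diff[OF approx[OF that, of m] approximates_rounded[OF N, of "r' * x + s'"]] by simp
    \<comment> \<open>By soundness all far points are true exceptions, so there are few of them and
      \<open>pts\<close> applies.\<close>
    have "?FP \<subseteq> {x \<in> Z. \<not> ?n dvd \<Phi> x - (r * x + s)}"
    proof
      fix x assume x: "x \<in> ?FP"
      then have xV: "x \<in> V" by (simp add: far_points_def)
      have "\<not> ?n dvd \<Phi> x - (r * x + s)"
      proof
        assume "?n dvd \<Phi> x - (r * x + s)"
        then have "?n dvd m * (\<Phi> x - (r * x + s))" by simp
        then have "?n dvd m * \<Phi> x - (r' * x + s')" using cong[of x] by (simp add: dvd_eq_mod_eq_0)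
        then have "\<not> far_mod_150 (forced_value N B (g m) x - rounded N (r' * x + s'))"
          by (intro not_far_mod_150[OF N approx'[OF xV]]) simp
        then show False using x by (simp add: far_points_def)
      qed
      then show "x \<in> {x \<in> Z. \<not> ?n dvd \<Phi> x - (r * x + s)}" using xV VZ by auto
    qed
    then have "card ?FP \<le> card {x \<in> Z. \<not> ?n dvd \<Phi> x - (r * x + s)}"
      using fin by (intro card_mono) auto
    then have "card ?FP \<le> 4 * c * N" using few by linarith
    then have le: "card ((A - W) \<inter> ?FP) \<le> 32 * c * n" by (rule pts[OF g rs'])
    have "{a \<in> D. far_from_zero N (m * (\<Phi> a - (r * a + s)))} \<subseteq> (A - W) \<inter> ?FP"
    proof clarify
      fix a assume a: "a \<in> D" "far_from_zero N (m * (\<Phi> a - (r * a + s)))"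
      have aD: "a \<in> A - W" using a by (auto simp: D_def E_def)
      then have aV: "a \<in> V" using DV by blast
      have "far_from_zero N (m * \<Phi> a - (r' * a + s'))"
        using a(2) cong[of a] far_from_zero_mod by metis
      then have "far_mod_150 (forced_value N B (g m) a - rounded N (r' * a + s'))"
        by (intro far_mod_150I[OF N approx'[OF aV]]) simp_all
      then show "a \<in> (A - W) \<inter> ?FP" using aD aV by (simp add: far_points_def)
    qed
    then have "card {a \<in> D. far_from_zero N (m * (\<Phi> a - (r * a + s)))} \<le> card ((A - W) \<inter> ?FP)"
      using fin by (intro card_mono) auto
    then show ?thesis using m le by linarith
  qed
  \<comment> \<open>Nothing is known about \<open>\<phi>\<close> versus the affine map on
    \<open>B\<close>, so all of \<open>B\<close> is counted as exceptional; it is small because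
    \<open>W\<close> is sparse.\<close>
  have "card E \<le> card (D \<union> B)"
    using fin by (intro card_mono) (auto simp: D_def E_def B_def)
  also have "\<dots> \<le> card D + card B" by (rule card_Un_le)
  finally have "real (card E) \<le> 64 * c * n + 8 * \<rho> * n" using D cB by linarith
  also have "\<dots> = (64 * c + 8 * \<rho>) * n" by (simp add: algebra_simps)
  also have "\<dots> \<le> 1 / 3500 * n" using c n by (intro mult_right_mono) auto
  finally have "card E \<le> n / 3500" by simp
  then have "\<not> isolated_subset N A E" using iso by blast
  then show ?thesis
    unfolding E_def using rs by (intro freiman_hom_affine_if_isolated_free[OF N hom]) (auto simp: Z_def)
qed

section \<open>Probabilities of the exceptional events\<close>

text \<open>Independence of \<open>A \<inter> W\<close> and \<open>A - W\<close>: the first can be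
  fixed before averaging over the second.\<close>

lemma subset_expectation_split:
  assumes "finite Z" "W \<subseteq> Z"
  shows "subset_expectation p Z (\<lambda>A. f (A \<inter> W) (A - W)) =
    subset_expectation p W (\<lambda>B. subset_expectation p (Z - W) (\<lambda>D. f B D))"
proof -
  have fin: "finite W" "finite (Z - W)" using assms by (auto intro: finite_subset)
  have "subset_expectation p (W \<union> (Z - W)) (\<lambda>A. f (A \<inter> W) (A - W)) =
    subset_expectation p W (\<lambda>B. subset_expectation p (Z - W) (\<lambda>D. f ((B \<union> D) \<inter> W) ((B \<union> D) - W)))"
    using fin by (intro subset_expectation_Un) auto
  also have "\<dots> = subset_expectation p W (\<lambda>B. subset_expectation p (Z - W) (\<lambda>D. f B D))"
  proof (intro subset_expectation_cong)
    fix B D assume "B \<subseteq> W" "D \<subseteq> Z - W"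
    then have "(B \<union> D) \<inter> W = B" "(B \<union> D) - W = D" by auto
    then show "f ((B \<union> D) \<inter> W) ((B \<union> D) - W) = f B D" by simp
  qed
  finally show ?thesis using assms(2) by (simp add: Un_absorb1)
qed

lemma subset_expectation_restrict:
  assumes "finite Z" "W \<subseteq> Z"
  shows "subset_expectation p Z (\<lambda>A. f (A \<inter> W)) = subset_expectation p W f"
  using subset_expectation_split[OF assms, of p "\<lambda>B D. f B"] assms(1) by (simp add: finite_subset)

lemma subset_expectation_union_bound:
  fixes b :: real
  assumes "finite I" "0 \<le> p" "p \<le> 1"
    and "\<And>i. i \<in> I \<Longrightarrow> subset_expectation p S (\<lambda>A. of_bool (R i A)) \<le> b"
  shows "subset_expectation p S (\<lambda>A. of_bool (\<exists>i\<in>I. R i A)) \<le> card I * b"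
proof -
  have "of_bool (\<exists>i\<in>I. R i A) \<le> (\<Sum>i\<in>I. of_bool (R i A) :: real)" for A
  proof (cases "\<exists>i\<in>I. R i A")
    case True
    then obtain i where i: "i \<in> I" "R i A" by blast
    then have "of_bool (R i A) \<le> (\<Sum>i\<in>I. of_bool (R i A) :: real)"
      using assms(1) by (intro member_le_sum) auto
    with i True show ?thesis by simp
  qed (simp add: sum_nonneg)
  then have "subset_expectation p S (\<lambda>A. of_bool (\<exists>i\<in>I. R i A))
      \<le> subset_expectation p S (\<lambda>A. \<Sum>i\<in>I. of_bool (R i A))"
    using assms by (intro subset_expectation_mono)
  also have "\<dots> \<le> (\<Sum>i\<in>I. b)"
    unfolding subset_expectation_sum using assms(4) by (rule sum_mono)
  finally show ?thesis by simp
qed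

text \<open>\<open>Janson_triples\<close> with the single target \<open>x\<close>: the denominator
  is at most \<open>4 * (9 + 27 + 27) = 252\<close>, so \<open>504 * ln N\<close> gives probability
  at most \<open>1 / N\<^sup>2\<close> for each \<open>x\<close>.\<close>

lemma prob_unrepresented:
  fixes N :: nat and p \<kappa> :: real
  assumes N: "1 \<le> N" and p: "0 \<le> p" "p \<le> 1" and u: "N * p\<^sup>2 \<le> 1"
    and W: "W \<subseteq> residues_below N"
    and gen: "\<And>x. x \<in> residues_below N - W \<Longrightarrow> \<exists>F. F \<subseteq> {(b, c, d). b \<in> W \<and> c \<in> W \<and> d \<in> W \<and>
        b \<noteq> c \<and> b \<noteq> d \<and> c \<noteq> d \<and> (c + d - b) mod int N \<in> {x}} \<and> \<kappa> * (real N)\<^sup>2 \<le> card F"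
    and lam: "504 * ln N \<le> \<kappa> * ((real N)\<^sup>2 * p ^ 3)"
  shows "subset_expectation p (residues_below N)
      (\<lambda>A. of_bool (\<exists>x\<in>residues_below N - W. \<not> represented N (A \<inter> W) x)) \<le> 1 / N"
proof -
  let ?Z = "residues_below N"
  have single: "subset_expectation p W (\<lambda>B. of_bool (\<not> represented N B x)) \<le> exp (- 2 * ln N)"
    if x: "x \<in> ?Z - W" for x
  proof -
    obtain F where F: "F \<subseteq> {(b, c, d). b \<in> W \<and> c \<in> W \<and> d \<in> W \<and>
        b \<noteq> c \<and> b \<noteq> d \<and> c \<noteq> d \<and> (c + d - b) mod int N \<in> {x}}" "\<kappa> * (real N)\<^sup>2 \<le> card F"
      using gen[OF x] by (elim exE conjE) (rule that)
    have "subset_expectation p W (\<lambda>B. of_bool (\<not> represented N B x))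
      \<le> subset_expectation p W (\<lambda>B. of_bool (\<forall>(b, c, d)\<in>F. \<not> {b, c, d} \<subseteq> B))"
    proof (intro subset_expectation_mono p)
      fix B
      have "\<forall>(b, c, d)\<in>F. \<not> {b, c, d} \<subseteq> B" if "\<not> represented N B x"
      proof (rule ccontr)
        assume "\<not> ?thesis"
        then obtain b c d where "(b, c, d) \<in> F" "b \<in> B" "c \<in> B" "d \<in> B" by auto
        moreover from this F(1) have "(c + d - b) mod int N = x" by auto
        ultimately show False using that unfolding represented_def by metis
      qed
      then show "of_bool (\<not> represented N B x) \<le> (of_bool (\<forall>(b, c, d)\<in>F. \<not> {b, c, d} \<subseteq> B) :: real)"
        by simp
    qed
    also have "\<dots> \<le> exp (- (\<kappa> * ((real N)\<^sup>2 * p ^ 3)) / (4 * (9 * real (card {x}) * (N * p\<^sup>2) + 27 * real (card {x}) * p + 27)))"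
    proof (rule Janson_triples[OF p W _ F(1)])
      show "\<kappa> * ((real N)\<^sup>2 * p ^ 3) \<le> real (card F) * p ^ 3"
        using mult_right_mono[OF F(2), of "p ^ 3"] p by (simp add: mult_ac)
    qed simp
    also have "\<dots> \<le> exp (- 2 * ln N)"
    proof -
      have den: "0 < 4 * (9 * (N * p\<^sup>2) + 27 * p + 27)" using p by (simp add: add_nonneg_pos)
      have le: "4 * (9 * (N * p\<^sup>2) + 27 * p + 27) \<le> 252" using p u by simp
      have L: "0 \<le> ln (real N)" using N by simp
      have "2 * ln N * (4 * (9 * (N * p\<^sup>2) + 27 * p + 27)) \<le> 2 * ln N * 252"
        using le L by (intro mult_left_mono) auto
      then have "2 * ln N * (4 * (9 * (N * p\<^sup>2) + 27 * p + 27)) \<le> \<kappa> * ((real N)\<^sup>2 * p ^ 3)"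
        using lam by linarith
      then have "2 * ln N \<le> \<kappa> * ((real N)\<^sup>2 * p ^ 3) / (4 * (9 * (N * p\<^sup>2) + 27 * p + 27))"
        using den by (simp only: pos_le_divide_eq)
      then show ?thesis by simp
    qed
    finally show ?thesis .
  qed
  have "subset_expectation p ?Z (\<lambda>A. of_bool (\<exists>x\<in>?Z - W. \<not> represented N (A \<inter> W) x))
    = subset_expectation p W (\<lambda>B. of_bool (\<exists>x\<in>?Z - W. \<not> represented N B x))"
    using W by (intro subset_expectation_restrict) auto
  also have "\<dots> \<le> card (?Z - W) * exp (- 2 * ln N)"
    using single by (intro subset_expectation_union_bound p) auto
  also have "\<dots> \<le> N * exp (- 2 * ln N)"
    using card_mono[of ?Z "?Z - W"] by (intro mult_right_mono) auto
  also have "exp (- 2 * ln N) = 1 / (real N)\<^sup>2"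
  proof -
    have "exp (2 * ln (real N)) = (real N)\<^sup>2"
      using N exp_of_nat_mult[of 2 "ln (real N)"] by simp
    then show ?thesis by (simp add: exp_minus inverse_eq_divide)
  qed
  also have "N * (1 / (real N)\<^sup>2) = 1 / N" using N by (simp add: power2_eq_square)
  finally show ?thesis .
qed

lemma card_functions_le:
  fixes t :: real
  assumes "finite B" "card B \<le> t"
  shows "card (PiE B (\<lambda>_. {0..<150::int})) \<le> exp (8 * t)"
proof -
  have "(150::real) \<le> 2 ^ 8" by simp
  also have "\<dots> \<le> exp 1 ^ 8"
    using exp_ge_add_one_self[of "1::real"] by (intro power_mono) auto
  also have "\<dots> = exp 8" by (simp add: exp_of_nat_mult[symmetric])
  finally have "(150::real) ^ card B \<le> exp 8 ^ card B" by (intro power_mono) auto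
  also have "\<dots> = exp (8 * card B)" by (simp add: exp_of_nat_mult[symmetric] mult.commute)
  also have "\<dots> \<le> exp (8 * t)" using assms by simp
  finally show ?thesis using assms by (simp add: card_PiE)
qed

text \<open>For fixed \<open>A \<inter> W\<close> and \<open>g\<close> the far quadruples are fixed
  and only \<open>A - W\<close> is random. Janson's bound \<open>exp (- c N p / 256)\<close>
  survives the union over at most \<open>exp (8 * t)\<close> maps \<open>g\<close>, leaving half of
  the exponent.\<close>

lemma prob_no_far_quadruple:
  fixes N :: nat and p c t :: real
  assumes p: "0 \<le> p" "p \<le> 1" and u: "N * p\<^sup>2 \<le> 1" and lam: "38 \<le> (real N)\<^sup>2 * p ^ 3"
    and W: "W \<subseteq> residues_below N" and t: "0 \<le> c" "8 * t \<le> c * (N * p) / 512"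
  defines "V \<equiv> residues_below N - W"
  shows "subset_expectation p (residues_below N) (\<lambda>A. of_bool (card (A \<inter> W) \<le> t \<and>
      (\<exists>g\<in>PiE (A \<inter> W) (\<lambda>_. {0..<150}). c / 2 * real N ^ 3 \<le> card (far_quadruples N V (forced_value N (A \<inter> W) g)) \<and>
        (\<forall>(x, y, z, w)\<in>far_quadruples N V (forced_value N (A \<inter> W) g). \<not> {x, y, z, w} \<subseteq> A - W))))
    \<le> exp (- (c * (N * p) / 512))"
proof -
  let ?Z = "residues_below N"
  have finV: "finite V" by (simp add: V_def)
  define n where "n = N * p"
  define lm where "lm = (real N)\<^sup>2 * p ^ 3"
  let ?R = "\<lambda>B g D. c / 2 * real N ^ 3 \<le> card (far_quadruples N V (forced_value N B g)) \<and>
        (\<forall>(x, y, z, w)\<in>far_quadruples N V (forced_value N B g). \<not> {x, y, z, w} \<subseteq> D)"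
  have single: "subset_expectation p V (\<lambda>D. of_bool (?R B g D)) \<le> exp (- (c * n / 256))" for B g
  proof (cases "c / 2 * real N ^ 3 \<le> card (far_quadruples N V (forced_value N B g))")
    case True
    let ?F = "far_quadruples N V (forced_value N B g)"
    have "subset_expectation p V (\<lambda>D. of_bool (\<forall>(x, y, z, w)\<in>?F. \<not> {x, y, z, w} \<subseteq> D))
      \<le> exp (- (c / 2 * lm * n) / (4 * (16 * ((real N)\<^sup>2 * p ^ 3) + 96 * (N * p\<^sup>2) + 256 * p + 256)))"
    proof (rule Janson_quadruples[OF p])
      show "V \<subseteq> ?Z" by (auto simp: V_def)
      have "c / 2 * real N ^ 3 * p ^ 4 \<le> card ?F * p ^ 4" using True p by (intro mult_right_mono) auto
      also have "c / 2 * real N ^ 3 * p ^ 4 = c / 2 * lm * n"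
        unfolding lm_def n_def by (simp add: power2_eq_square power3_eq_cube power4_eq_xxxx)
      finally show "c / 2 * lm * n \<le> real (card ?F) * p ^ 4" .
    qed (auto simp: far_quadruples_def)
    also have "\<dots> \<le> exp (- (c * n / 256))"
    proof -
      \<comment> \<open>The lower-order terms total at most \<open>96 + 256 + 256 = 16 * 38\<close>,
        hence at most \<open>16 * lm\<close>.\<close>
      define \<delta> where "\<delta> = 16 * lm + 96 * (N * p\<^sup>2) + 256 * p + 256"
      have "38 \<le> lm" using lam by (simp add: lm_def)
      then have \<delta>: "0 < \<delta>" "\<delta> \<le> 32 * lm"
        using u p unfolding \<delta>_def by (simp_all add: add_nonneg_pos)
      have "c * n / 256 * (4 * \<delta>) \<le> c * n / 256 * (4 * (32 * lm))"
        using \<delta> t p by (intro mult_left_mono) (auto simp: n_def)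
      also have "\<dots> = c / 2 * lm * n" by simp
      finally have "c * n / 256 \<le> c / 2 * lm * n / (4 * \<delta>)"
        using \<delta> by (simp only: pos_le_divide_eq mult_pos_pos zero_less_numeral)
      then show ?thesis unfolding \<delta>_def lm_def by simp
    qed
    finally show ?thesis using True by simp
  qed (simp add: finV)
  have "subset_expectation p ?Z (\<lambda>A. of_bool (card (A \<inter> W) \<le> t \<and> (\<exists>g\<in>PiE (A \<inter> W) (\<lambda>_. {0..<150}). ?R (A \<inter> W) g (A - W))))
    = subset_expectation p W (\<lambda>B. subset_expectation p V (\<lambda>D. of_bool (card B \<le> t \<and> (\<exists>g\<in>PiE B (\<lambda>_. {0..<150}). ?R B g D))))"
    unfolding V_def
    using W by (intro subset_expectation_split[of ?Z W p
      "\<lambda>B D. of_bool (card B \<le> t \<and> (\<exists>g\<in>PiE B (\<lambda>_. {0..<150}). c / 2 * real N ^ 3 \<le> card (far_quadruples N (?Z - W) (forced_value N B g)) \<and>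
        (\<forall>(x, y, z, w)\<in>far_quadruples N (?Z - W) (forced_value N B g). \<not> {x, y, z, w} \<subseteq> D)))"]) auto
  also have "\<dots> \<le> exp (- (c * n / 512))"
  proof (rule subset_expectation_le_const[OF _ p])
    show "finite W" using W by (rule finite_subset) simp
    fix B assume "B \<subseteq> W"
    then have finB: "finite B" using \<open>finite W\<close> by (rule finite_subset)
    show "subset_expectation p V (\<lambda>D. of_bool (card B \<le> t \<and> (\<exists>g\<in>PiE B (\<lambda>_. {0..<150}). ?R B g D))) \<le> exp (- (c * n / 512))"
    proof (cases "card B \<le> t")
      case True
      have "subset_expectation p V (\<lambda>D. of_bool (\<exists>g\<in>PiE B (\<lambda>_. {0..<150}). ?R B g D))
        \<le> card (PiE B (\<lambda>_. {0..<150::int})) * exp (- (c * n / 256))"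
        using finB by (intro subset_expectation_union_bound p single finite_PiE) auto
      also have "\<dots> \<le> exp (8 * t) * exp (- (c * n / 256))"
        using card_functions_le[OF finB True] by (intro mult_right_mono) auto
      also have "\<dots> = exp (8 * t - c * n / 256)" by (simp add: exp_add[symmetric])
      also have "\<dots> \<le> exp (- (c * n / 512))" using t by (simp add: n_def)
      finally show ?thesis using True by simp
    qed (simp add: finV)
  qed
  finally show ?thesis unfolding n_def .
qed

text \<open>The threshold \<open>32 * c * (N * p)\<close> is eight times the largest allowed mean
  \<open>4 * c * N * p\<close>, as \<open>prob_card_Int_ge\<close> requires. The union runs over
  \<open>g\<close> and the \<open>N\<^sup>2\<close> affine maps.\<close>

lemma prob_many_far_points:
  fixes N :: nat and p c t :: real
  assumes N: "1 \<le> N" and p: "0 \<le> p" "p \<le> 1" and W: "W \<subseteq> residues_below N"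
    and t: "8 * t \<le> 16 * c * (N * p)"
  defines "V \<equiv> residues_below N - W"
  shows "subset_expectation p (residues_below N) (\<lambda>A. of_bool (card (A \<inter> W) \<le> t \<and>
      (\<exists>(g, r, s)\<in>PiE (A \<inter> W) (\<lambda>_. {0..<150}) \<times> residues_below N \<times> residues_below N.
        card (far_points N V (forced_value N (A \<inter> W) g) r s) \<le> 4 * c * N \<and>
        32 * c * (N * p) \<le> card ((A - W) \<inter> far_points N V (forced_value N (A \<inter> W) g) r s))))
    \<le> (real N)\<^sup>2 * exp (- (16 * c * (N * p)))"
proof -
  let ?Z = "residues_below N"
  let ?R = "\<lambda>B i D. case i of (g, r, s) \<Rightarrow> card (far_points N V (forced_value N B g) r s) \<le> 4 * c * N \<and>
        32 * c * (N * p) \<le> card (D \<inter> far_points N V (forced_value N B g) r s)"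
  have finV: "finite V" by (simp add: V_def)
  have single: "subset_expectation p V (\<lambda>D. of_bool (?R B i D)) \<le> exp (- (32 * c * (N * p)))" for B i
  proof (cases "card (far_points N V (forced_value N B (fst i)) (fst (snd i)) (snd (snd i))) \<le> 4 * c * N")
    case True
    let ?F = "far_points N V (forced_value N B (fst i)) (fst (snd i)) (snd (snd i))"
    have "V \<inter> ?F = ?F" by (auto simp: far_points_def)
    then have "8 * p * card (V \<inter> ?F) \<le> 8 * p * (4 * c * N)"
      using True p by (intro mult_left_mono) auto
    then have "subset_expectation p V (\<lambda>D. of_bool (32 * c * (N * p) \<le> card (D \<inter> ?F))) \<le> exp (- (32 * c * (N * p)))"
      by (intro prob_card_Int_ge finV p) (simp add: mult_ac)
    then show ?thesis using True by (simp add: case_prod_unfold)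
  qed (simp add: case_prod_unfold finV)
  have "subset_expectation p ?Z (\<lambda>A. of_bool (card (A \<inter> W) \<le> t \<and>
      (\<exists>i\<in>PiE (A \<inter> W) (\<lambda>_. {0..<150}) \<times> ?Z \<times> ?Z. ?R (A \<inter> W) i (A - W))))
    = subset_expectation p W (\<lambda>B. subset_expectation p V (\<lambda>D. of_bool (card B \<le> t \<and>
      (\<exists>i\<in>PiE B (\<lambda>_. {0..<150}) \<times> ?Z \<times> ?Z. ?R B i D))))"
    unfolding V_def
    using W by (intro subset_expectation_split[of ?Z W p
      "\<lambda>B D. of_bool (card B \<le> t \<and> (\<exists>(g, r, s)\<in>PiE B (\<lambda>_. {0..<150}) \<times> ?Z \<times> ?Z.
        card (far_points N (?Z - W) (forced_value N B g) r s) \<le> 4 * c * N \<and>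
        32 * c * (N * p) \<le> card (D \<inter> far_points N (?Z - W) (forced_value N B g) r s)))"]) auto
  also have "\<dots> \<le> (real N)\<^sup>2 * exp (- (16 * c * (N * p)))"
  proof (rule subset_expectation_le_const[OF _ p])
    show "finite W" using W by (rule finite_subset) simp
    fix B assume "B \<subseteq> W"
    then have finB: "finite B" using \<open>finite W\<close> by (rule finite_subset)
    show "subset_expectation p V (\<lambda>D. of_bool (card B \<le> t \<and>
      (\<exists>i\<in>PiE B (\<lambda>_. {0..<150}) \<times> ?Z \<times> ?Z. ?R B i D))) \<le> (real N)\<^sup>2 * exp (- (16 * c * (N * p)))"
    proof (cases "card B \<le> t")
      case True
      have "subset_expectation p V (\<lambda>D. of_bool (\<exists>i\<in>PiE B (\<lambda>_. {0..<150}) \<times> ?Z \<times> ?Z. ?R B i D))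
        \<le> card (PiE B (\<lambda>_. {0..<150::int}) \<times> ?Z \<times> ?Z) * exp (- (32 * c * (N * p)))"
        using finB by (intro subset_expectation_union_bound p single finite_cartesian_product finite_PiE) auto
      also have "\<dots> = card (PiE B (\<lambda>_. {0..<150::int})) * ((real N)\<^sup>2 * exp (- (32 * c * (N * p))))"
        by (simp only: card_cartesian_product card_residues_below) (simp add: power2_eq_square)
      also have "\<dots> \<le> exp (8 * t) * ((real N)\<^sup>2 * exp (- (32 * c * (N * p))))"
        using card_functions_le[OF finB True] by (intro mult_right_mono) auto
      also have "\<dots> = (real N)\<^sup>2 * exp (8 * t - 32 * c * (N * p))" by (simp add: exp_diff exp_minus field_simps)
      also have "\<dots> \<le> (real N)\<^sup>2 * exp (- (16 * c * (N * p)))"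
      proof -
        have "32 * c * (N * p) = 2 * (16 * c * (N * p))" by simp
        then have "8 * t - 32 * c * (N * p) \<le> - (16 * c * (N * p))" using t by linarith
        then show ?thesis by (intro mult_left_mono) auto
      qed
      finally show ?thesis using True by simp
    qed (simp add: finV)
  qed
  finally show ?thesis .
qed

section \<open>Union bound over the exceptional events, and the limit\<close>

lemma prob_all_freiman_homs_affine:
  fixes N M :: nat and p :: real
  defines "M \<equiv> 196608000000"
  assumes N: "4 * M\<^sup>2 \<le> N" and p: "0 \<le> p" "p \<le> 1" and u: "N * p\<^sup>2 \<le> 1"
    and lam: "4032 * real M ^ 3 * ln N \<le> (real N)\<^sup>2 * p ^ 3"
    and n: "1000000000000 * ln N \<le> N * p"
  shows "1 - 5 / N \<le> measure_pmf.prob (random_subset p (residues_below N))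
    {A. \<forall>\<phi>. freiman_hom N A \<phi> \<longrightarrow> affine_on N A \<phi>}"
proof -
  let ?Z = "residues_below N"
  \<comment> \<open>\<open>M = 6 * 2 ^ 15 * 10 ^ 6\<close>, so that \<open>64 * \<rho> = c / 512\<close>\<close>
  define \<rho> :: real where "\<rho> = 6 / real M"
  define c :: real where "c = 1 / 1000000"
  define \<kappa> :: real where "\<kappa> = 1 / (8 * real M ^ 3)"
  define m where "m = N * p"
  have NR: "1000 \<le> real N"
  proof -
    have "(1000::nat) \<le> 4 * M\<^sup>2" by (simp add: M_def)
    then show ?thesis using N by linarith
  qed
  have L: "1 \<le> ln (real N)"
  proof -
    have "exp 1 \<le> real N" using exp_le NR by linarith
    then show ?thesis using NR by (subst ln_ge_iff) auto
  qed
  \<comment> \<open>The bounds for \<open>F2\<close>, \<open>F3\<close> and \<open>F4\<close>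
    contain a factor exponentially small in \<open>m\<close>. The slowest rate is
    \<open>8 * \<rho>\<close>, about 2.4 / 10^10, so the factor 10^12 leaves ample room for
    \<open>1 / N\<close>.\<close>
  have m: "1000000000000 \<le> m" "1000000000000 * ln N \<le> m"
    using n L unfolding m_def by linarith+
  have decay: "exp (- x) \<le> 1 / N" if "ln N \<le> x" for x
  proof -
    have "exp (- x) \<le> exp (- ln N)" using that by simp
    also have "\<dots> = 1 / N" using NR by (simp add: exp_minus inverse_eq_divide)
    finally show ?thesis .
  qed
  obtain W where W: "W \<subseteq> ?Z" and cW: "card W * M \<le> 6 * N"
    and gen: "\<And>x. x \<in> ?Z - W \<Longrightarrow> \<exists>F. F \<subseteq> {(b, c, d). b \<in> W \<and> c \<in> W \<and> d \<in> W \<and>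
        b \<noteq> c \<and> b \<noteq> d \<and> c \<noteq> d \<and> (c + d - b) mod int N \<in> {x}} \<and>
      (real N)\<^sup>2 / (8 * real M ^ 3) \<le> card F"
    using ex_small_generating_set[of M N] N by (auto simp: M_def)
  define V where "V = ?Z - W"
  have cW': "card W \<le> \<rho> * N"
  proof -
    have "real (card W * M) \<le> real (6 * N)" using cW by (rule of_nat_mono)
    then show ?thesis by (simp add: \<rho>_def M_def)
  qed
  have N\<rho>: "2 \<le> \<rho> * N"
  proof -
    have "real M \<le> real (4 * M\<^sup>2)" by (simp add: M_def)
    also have "\<dots> \<le> real N" using N by (rule of_nat_mono)
    finally show ?thesis by (simp add: \<rho>_def M_def)
  qed
  define t where "t = 8 * \<rho> * m"
  \<comment> \<open>The negations of \<open>F1\<close> to \<open>F5\<close> supply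
    \<open>rep\<close>, \<open>cB\<close>, \<open>quad\<close>, \<open>pts\<close> and
    \<open>iso\<close>. \<open>F3\<close> and \<open>F4\<close> carry their own bound on
    \<open>card (A \<inter> W)\<close>, so the number of maps \<open>g\<close> is controlled without
    conditioning on \<open>F2\<close>.\<close>
  define F1 where "F1 A \<longleftrightarrow> (\<exists>x\<in>V. \<not> represented N (A \<inter> W) x)" for A
  define F2 where "F2 A \<longleftrightarrow> t \<le> card (A \<inter> W)" for A
  define F3 where "F3 A \<longleftrightarrow> card (A \<inter> W) \<le> t \<and>
      (\<exists>g\<in>PiE (A \<inter> W) (\<lambda>_. {0..<150}). c / 2 * real N ^ 3 \<le> card (far_quadruples N V (forced_value N (A \<inter> W) g)) \<and>
        (\<forall>(x, y, z, w)\<in>far_quadruples N V (forced_value N (A \<inter> W) g). \<not> {x, y, z, w} \<subseteq> A - W))" for A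
  define F4 where "F4 A \<longleftrightarrow> card (A \<inter> W) \<le> t \<and>
      (\<exists>(g, r, s)\<in>PiE (A \<inter> W) (\<lambda>_. {0..<150}) \<times> ?Z \<times> ?Z.
        card (far_points N V (forced_value N (A \<inter> W) g) r s) \<le> 4 * c * N \<and>
        32 * c * m \<le> card ((A - W) \<inter> far_points N V (forced_value N (A \<inter> W) g) r s))" for A
  define F5 where "F5 A \<longleftrightarrow> (\<exists>E. isolated_subset N A E \<and> card E \<le> m / 3500)" for A
  let ?P = "\<lambda>F. subset_expectation p ?Z (\<lambda>A. of_bool (F A))"
  have P1: "?P F1 \<le> 1 / N"
    unfolding F1_def V_def
  proof (rule prob_unrepresented[OF _ p u W])
    fix x assume "x \<in> ?Z - W"
    then show "\<exists>F. F \<subseteq> {(b, c, d). b \<in> W \<and> c \<in> W \<and> d \<in> W \<and>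
        b \<noteq> c \<and> b \<noteq> d \<and> c \<noteq> d \<and> (c + d - b) mod int N \<in> {x}} \<and> \<kappa> * (real N)\<^sup>2 \<le> card F"
      using gen by (simp add: \<kappa>_def)
  next
    show "504 * ln N \<le> \<kappa> * ((real N)\<^sup>2 * p ^ 3)"
      using lam by (simp add: \<kappa>_def M_def)
  qed (use NR in simp)
  have P2: "?P F2 \<le> 1 / N"
  proof -
    have "?P F2 \<le> exp (- t)"
      unfolding F2_def
    proof (rule prob_card_Int_ge[OF _ p])
      have "8 * p * card (?Z \<inter> W) \<le> 8 * p * (\<rho> * N)"
        using W cW' p by (intro mult_left_mono) (auto simp: Int_absorb1)
      then show "8 * p * card (?Z \<inter> W) \<le> t" by (simp add: t_def m_def mult_ac)
    qed simp
    also have "\<dots> \<le> 1 / N"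
      using m L by (intro decay) (simp add: t_def \<rho>_def M_def)
    finally show ?thesis .
  qed
  have P3: "?P F3 \<le> 1 / N"
  proof -
    have "?P F3 \<le> exp (- (c * (N * p) / 512))"
      unfolding F3_def V_def
    proof (rule prob_no_far_quadruple[OF p u _ W])
      have "38 \<le> 4032 * real M ^ 3 * ln N"
        using mult_left_mono[OF L, of "4032 * real M ^ 3"] by (simp add: M_def)
      then show "38 \<le> (real N)\<^sup>2 * p ^ 3" using lam by linarith
      show "8 * t \<le> c * (N * p) / 512"
        by (simp add: t_def c_def \<rho>_def M_def m_def)
    qed (simp add: c_def)
    also have "\<dots> \<le> 1 / N"
      unfolding m_def[symmetric] using m L by (intro decay) (simp add: c_def)
    finally show ?thesis .
  qed
  have P4: "?P F4 \<le> 1 / N"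
  proof -
    have "?P F4 \<le> (real N)\<^sup>2 * exp (- (16 * c * (N * p)))"
      unfolding F4_def V_def m_def
    proof (rule prob_many_far_points[OF _ p W])
      show "8 * t \<le> 16 * c * (N * p)"
        using p by (simp add: t_def c_def \<rho>_def M_def m_def)
    qed (use NR in simp)
    also have "\<dots> = exp (2 * ln N) * exp (- (16 * c * (N * p)))"
      using NR exp_of_nat_mult[of 2 "ln (real N)"] by simp
    also have "\<dots> = exp (- (16 * c * m - 2 * ln N))"
      by (simp add: exp_add[symmetric] m_def)
    also have "\<dots> \<le> 1 / N"
      using m L by (intro decay) (simp add: c_def)
    finally show ?thesis .
  qed
  have P5: "?P F5 \<le> 1 / N"
    unfolding F5_def m_def
  proof (rule prob_isolated_subset[OF _ p u])
    have "2592 * ln N \<le> 4032 * real M ^ 3 * ln N"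
      using L by (intro mult_right_mono) (auto simp: M_def)
    then show "2592 * ln N \<le> (real N)\<^sup>2 * p ^ 3" using lam by linarith
    show "600 * ln N \<le> N * p" using n L by linarith
  qed (use NR in simp)
  have affine: "affine_on N A \<phi>"
    if A: "A \<subseteq> ?Z" and good: "\<not> F1 A" "\<not> F2 A" "\<not> F3 A" "\<not> F4 A" "\<not> F5 A" and hom: "freiman_hom N A \<phi>" for A \<phi>
  proof (rule freiman_homs_affine[OF _ A W cW' N\<rho> _ _ _ _ _ _ _ _ _ hom])
    show "0 < N" using NR by simp
    show "5 * \<rho> \<le> c" "12 * c < 1" "64 * c + 8 * \<rho> \<le> 1 / 3500"
      by (simp_all add: c_def \<rho>_def M_def)
    show "0 \<le> m" using m by simp
    have B: "card (A \<inter> W) \<le> t" using good(2) by (simp add: F2_def)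
    then show "card (A \<inter> W) \<le> 8 * \<rho> * m" by (simp add: t_def)
    show "\<not> card E \<le> m / 3500" if "isolated_subset N A E" for E
      using good(5) that unfolding F5_def by blast
    show "represented N (A \<inter> W) x" if "x \<in> ?Z - W" for x
      using good(1) that unfolding F1_def V_def by blast
    show "\<exists>(x, y, z, w)\<in>far_quadruples N (?Z - W) (forced_value N (A \<inter> W) g). {x, y, z, w} \<subseteq> A - W"
      if "g \<in> PiE (A \<inter> W) (\<lambda>_. {0..<150})"
        "c / 2 * real N ^ 3 \<le> card (far_quadruples N (?Z - W) (forced_value N (A \<inter> W) g))" for g
      using good(3) B that unfolding F3_def V_def by blast
    show "card ((A - W) \<inter> far_points N (?Z - W) (forced_value N (A \<inter> W) g) r s) \<le> 32 * c * m"
      if "g \<in> PiE (A \<inter> W) (\<lambda>_. {0..<150})" "r \<in> ?Z" "s \<in> ?Z"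
        "card (far_points N (?Z - W) (forced_value N (A \<inter> W) g) r s) \<le> 4 * c * N" for g r s
    proof (rule ccontr)
      assume "\<not> ?thesis"
      then have "F4 A"
        unfolding F4_def V_def using B that by (intro conjI bexI[of _ "(g, r, s)"]) auto
      then show False using good(4) by simp
    qed
  qed
  have "1 - 5 / N \<le> 1 - (?P F1 + ?P F2 + ?P F3 + ?P F4 + ?P F5)"
    using P1 P2 P3 P4 P5 by simp
  also have "\<dots> = subset_expectation p ?Z (\<lambda>A. 1 + - 1 * (of_bool (F1 A) + of_bool (F2 A) + of_bool (F3 A) + of_bool (F4 A) + of_bool (F5 A)))"
    by (simp only: subset_expectation_add subset_expectation_cmult subset_expectation_const finite_residues_below) simp
  also have "\<dots> \<le> subset_expectation p ?Z (\<lambda>A. of_bool (A \<in> {A. \<forall>\<phi>. freiman_hom N A \<phi> \<longrightarrow> affine_on N A \<phi>}))"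
  proof (intro subset_expectation_mono p)
    fix A assume A: "A \<subseteq> ?Z"
    show "1 + - 1 * (of_bool (F1 A) + of_bool (F2 A) + of_bool (F3 A) + of_bool (F4 A) + of_bool (F5 A))
      \<le> (of_bool (A \<in> {A. \<forall>\<phi>. freiman_hom N A \<phi> \<longrightarrow> affine_on N A \<phi>}) :: real)"
    proof (cases "F1 A \<or> F2 A \<or> F3 A \<or> F4 A \<or> F5 A")
      case True
      then show ?thesis by (elim disjE) simp_all
    next
      case False
      then show ?thesis using affine[OF A] by simp
    qed
  qed
  also have "\<dots> = measure_pmf.prob (random_subset p ?Z) {A. \<forall>\<phi>. freiman_hom N A \<phi> \<longrightarrow> affine_on N A \<phi>}"
    using p by (intro prob_random_subset[symmetric]) auto
  finally show ?thesis .
qed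

lemma powr_minus_two_thirds_cubed:
  fixes x :: real
  assumes "0 < x"
  shows "(x powr (-2/3)) ^ 3 = 1 / x\<^sup>2"
proof -
  have "(x powr (-2/3)) ^ 3 = x powr (real 3 * (-2/3))"
    using assms by (intro powr_power) simp
  also have "real 3 * (-2/3) = - 2" by simp
  also have "x powr - 2 = 1 / x powr 2" by (rule powr_minus_divide)
  also have "x powr 2 = x\<^sup>2" using assms by (rule powr_numeral[OF order_less_imp_le])
  finally show ?thesis .
qed

theorem theorem1p1:
  shows "\<exists>C>0::real.
    (\<lambda>N::nat. measure_pmf.prob
        (random_subset (C * ln (real N) powr (1/3) * real N powr (-2/3)) (carrier (Z_mod N)))
        {A. \<forall>\<phi>. freiman_hom N A \<phi> \<longrightarrow> affine_on N A \<phi>})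
    \<longlonglongrightarrow> 1"
proof -
  define M :: nat where "M = 196608000000"
  \<comment> \<open>Then \<open>N\<^sup>2 p ^ 3 = C ^ 3 ln N\<close> with
    \<open>C ^ 3 = 4096 M ^ 3\<close>, just above the required \<open>4032 M ^ 3\<close>; here
    \<open>4032 = 8 * 504\<close>.\<close>
  define C :: real where "C = 16 * real M"
  define p where "p N = C * ln (real N) powr (1/3) * real N powr (-2/3)" for N :: nat
  define P where "P N = measure_pmf.prob (random_subset (p N) (carrier (Z_mod N)))
        {A. \<forall>\<phi>. freiman_hom N A \<phi> \<longrightarrow> affine_on N A \<phi>}" for N
  have C: "0 < C" by (simp add: C_def M_def)
  have Z: "carrier (Z_mod N) = residues_below N" for N
    unfolding residue_ring_def residues_below_def by auto
  have le1: "eventually (\<lambda>N. p N \<le> 1) sequentially"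
    unfolding p_def using C by real_asymp
  \<comment> \<open>Up to logarithms \<open>p N\<close> is \<open>N\<close> to the power -2/3, so
    \<open>N * (p N)\<^sup>2\<close> tends to 0 while \<open>N * p N\<close> grows like the cube
    root of \<open>N\<close>.\<close>
  have u: "eventually (\<lambda>N. N * (p N)\<^sup>2 \<le> 1) sequentially"
    unfolding p_def using C by real_asymp
  have n: "eventually (\<lambda>N. 1000000000000 * ln N \<le> N * p N) sequentially"
    unfolding p_def using C by real_asymp
  have "eventually (\<lambda>N. 1 - 5 / real N \<le> P N) sequentially"
    using le1 u n eventually_ge_at_top[of "4 * M\<^sup>2"] eventually_ge_at_top[of 3]
  proof eventually_elim
    case (elim N)
    have p0: "0 \<le> p N" using C by (simp add: p_def)
    have L: "0 < ln (real N)" using elim(5) by simp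
    have "(p N) ^ 3 = C ^ 3 * (ln (real N) powr (1/3)) ^ 3 * (real N powr (-2/3)) ^ 3"
      by (simp add: p_def power_mult_distrib)
    also have "(ln (real N) powr (1/3)) ^ 3 = ln (real N)"
      using L by (simp add: powr_power)
    also have "(real N powr (-2/3)) ^ 3 = 1 / (real N)\<^sup>2"
      using elim(5) by (intro powr_minus_two_thirds_cubed) simp
    finally have "(real N)\<^sup>2 * (p N) ^ 3 = C ^ 3 * ln N" using elim(5) by simp
    also have "\<dots> \<ge> 4032 * real M ^ 3 * ln N"
      using L by (intro mult_right_mono) (auto simp: C_def power_mult_distrib)
    finally show ?case
      unfolding P_def Z using elim p0
      by (intro prob_all_freiman_homs_affine) (simp_all add: M_def)
  qed
  moreover have "eventually (\<lambda>N. P N \<le> 1) sequentially"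
    by (simp add: P_def)
  moreover have "(\<lambda>N. 1 - 5 / real N) \<longlonglongrightarrow> 1"
    by real_asymp
  ultimately have "P \<longlonglongrightarrow> 1"
    by (rule tendsto_sandwich[OF _ _ _ tendsto_const])
  with C show ?thesis
    unfolding P_def[abs_def] p_def by (intro exI[of _ C] conjI)
qed

end
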